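(* Let $\mathbb{K}$ be a field of characteristic zero and let $n\ge 2$. If $\theta\in \mathrm{SA}_n(\mathbb{K})$ is $4$-triangular and $\theta\neq \mathrm{id}$, then $\theta$ is normally co-tame, i.e. $\langle\theta\rangle^S\supseteq \mathrm{SLIN}_n(\mathbb{K})$.
   Context: $\mathrm{GA}_n(\mathbb{K})$ is the group of polynomial automorphisms of $\mathbb{A}^n$ over $\mathbb{K}$. An element is written $\phi=(H_1,\dots,H_n)$ with $H_i\in\mathbb{K}[x_1,\dots,x_n]$; it acts on polynomials on the right by $(P)\phi=P(H_1,\dots,H_n)$, and products satisfy $(P)(\phi\psi)=((P)\phi)\psi$ (so $\phi\psi$ is the usual composition $\phi\circ\psi$ of polynomial maps). $\mathrm{SA}_n(\mathbb{K})$ is the subgroup of automorphisms with Jacobian determinant $1$. $\mathrm{Aff}_n(\mathbb{K})$ is the group of automorphisms of degree one. $\mathrm{BA}_n(\mathbb{K})$ is the group of triangular automorphisms $(a_1x_1+P_1,a_2x_2+P_2(x_1),\dots,a_nx_n+P_n(x_1,\dots,x_{n-1}))$ with $a_i\in\mathbb{K}^*$, $P_i\in\mathbb{K}[x_1,\dots,x_{i-1}]$. An automorphism $\phi$ is $m$-triangular if $\phi=\alpha_0\tau_1\alpha_1\cdots\tau_m\alpha_m$ for some $\tau_i\in\mathrm{BA}_n(\mathbb{K})$ and $\alpha_i\in\mathrm{Aff}_n(\mathbb{K})$. For $H\subseteq\mathrm{SA}_n(\mathbb{K})$, $\langle H\rangle^S$ is the normal subgroup of $\mathrm{SA}_n(\mathbb{K})$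 generated by $H$ (and $\langle\theta\rangle^S=\langle\{\theta\}\rangle^S$). $\mathrm{SLIN}_n(\mathbb{K})=\langle \mathrm{SL}_n(\mathbb{K})\rangle^S$, where $\mathrm{SL}_n(\mathbb{K})$ is viewed as the group of linear automorphisms of determinant $1$. An element $\theta\in\mathrm{SA}_n(\mathbb{K})$ is normally co-tame if $\langle\theta\rangle^S\supseteq\mathrm{SLIN}_n(\mathbb{K})$. *)

theory Defs
  imports
    "HOL-Library.Poly_Mapping"
    "HOL-Library.FuncSet"
    "HOL-Algebra.Coset"
    "Jordan_Normal_Form.Determinant"
begin

section \<open>Polynomials in the variables \<open>x\<^sub>0, x\<^sub>1, \<dots>\<close>\<close>

type_synonym 'k mpoly = "(nat \<Rightarrow>\<^sub>0 nat) \<Rightarrow>\<^sub>0 'k"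

definition Const :: "'k::zero \<Rightarrow> 'k mpoly"
  where "Const a = Poly_Mapping.single 0 a"

definition Var :: "nat \<Rightarrow> 'k::zero_neq_one mpoly"
  where "Var i = Poly_Mapping.single (Poly_Mapping.single i 1) 1"

text \<open>Variables are indexed from 0: \<open>polys n\<close> is the polynomial ring in the first \<open>n\<close> variables
  \<open>x\<^sub>0, \<dots>, x\<^bsub>n-1\<^esub>\<close>; in particular \<open>polys 0\<close> consists of the constants.\<close>

definition polys :: "nat \<Rightarrow> 'k::zero mpoly set"
  where "polys n = {p. \<forall>m\<in>Poly_Mapping.keys p. Poly_Mapping.keys m \<subseteq> {..<n}}"

definition total_degree :: "'k::zero mpoly \<Rightarrow> nat"
  where "total_degree p =
    Max (insert 0 ((\<lambda>m. \<Sum>i\<in>Poly_Mapping.keys m. Poly_Mapping.lookup m i) ` Poly_Mapping.keys p))"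

definition psubst :: "(nat \<Rightarrow> 'k::comm_ring_1 mpoly) \<Rightarrow> 'k mpoly \<Rightarrow> 'k mpoly"
  where "psubst H p = (\<Sum>m\<in>Poly_Mapping.keys p.
    Const (Poly_Mapping.lookup p m) *
    (\<Prod>i\<in>Poly_Mapping.keys m. H i ^ Poly_Mapping.lookup m i))"

text \<open>In \<open>partial_deriv\<close>, the subtraction of exponents is truncated only for monomials that
  do not contain \<open>x\<^sub>i\<close>, and for those the coefficient vanishes.\<close>

definition partial_deriv :: "nat \<Rightarrow> 'k::comm_ring_1 mpoly \<Rightarrow> 'k mpoly"
  where "partial_deriv i p = (\<Sum>m\<in>Poly_Mapping.keys p.
    Poly_Mapping.single (m - Poly_Mapping.single i 1)
      (of_nat (Poly_Mapping.lookup m i) * Poly_Mapping.lookup p m))"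


section \<open>Polynomial automorphisms of affine space\<close>

text \<open>An endomorphism \<open>(H\<^sub>0, \<dots>, H\<^bsub>n-1\<^esub>)\<close> is an extensional function on \<open>{..<n}\<close>.
  The product \<open>\<phi> \<otimes> \<psi>\<close> satisfies \<open>(P)(\<phi> \<otimes> \<psi>) = ((P)\<phi>)\<psi>\<close>, where \<open>(P)\<phi>\<close> is \<open>psubst \<phi> P\<close>.\<close>

definition poly_endos :: "nat \<Rightarrow> (nat \<Rightarrow> 'k::comm_ring_1 mpoly) monoid"
  where "poly_endos n =
    \<lparr>carrier = {..<n} \<rightarrow>\<^sub>E polys n,
     monoid.mult = (\<lambda>\<phi> \<psi>. \<lambda>i\<in>{..<n}. psubst \<psi> (\<phi> i)),
     one = (\<lambda>i\<in>{..<n}. Var i)\<rparr>"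

definition GA :: "nat \<Rightarrow> (nat \<Rightarrow> 'k::comm_ring_1 mpoly) monoid"
  where "GA n = units_of (poly_endos n)"

definition jacobian :: "nat \<Rightarrow> (nat \<Rightarrow> 'k::comm_ring_1 mpoly) \<Rightarrow> 'k mpoly mat"
  where "jacobian n \<phi> = mat n n (\<lambda>(i, j). partial_deriv j (\<phi> i))"

definition SA :: "nat \<Rightarrow> (nat \<Rightarrow> 'k::comm_ring_1 mpoly) monoid"
  where "SA n = (GA n)\<lparr>carrier := {\<phi> \<in> carrier (GA n). det (jacobian n \<phi>) = 1}\<rparr>"

definition Aff :: "nat \<Rightarrow> (nat \<Rightarrow> 'k::comm_ring_1 mpoly) set"
  where "Aff n = {\<phi> \<in> carrier (GA n). Max ((\<lambda>i. total_degree (\<phi> i)) ` {..<n}) = 1}"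

definition BA :: "nat \<Rightarrow> (nat \<Rightarrow> 'k::field mpoly) set"
  where "BA n = {\<phi> \<in> carrier (GA n). \<exists>a P. \<forall>i<n.
    a i \<noteq> 0 \<and> P i \<in> polys i \<and> \<phi> i = Const (a i) * Var i + P i}"

definition linear_endo :: "nat \<Rightarrow> 'k::comm_ring_1 mat \<Rightarrow> nat \<Rightarrow> 'k mpoly"
  where "linear_endo n A = (\<lambda>i\<in>{..<n}. \<Sum>j<n. Const (A $$ (i, j)) * Var j)"

definition SL :: "nat \<Rightarrow> (nat \<Rightarrow> 'k::comm_ring_1 mpoly) set"
  where "SL n = linear_endo n ` {A \<in> carrier_mat n n. det A = 1}"

definition m_triangular :: "nat \<Rightarrow> nat \<Rightarrow> (nat \<Rightarrow> 'k::field mpoly) \<Rightarrow> bool"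
  where "m_triangular n m \<phi> \<longleftrightarrow> (\<exists>\<alpha> \<tau>.
    (\<forall>i\<in>{0..m}. \<alpha> i \<in> Aff n) \<and> (\<forall>i\<in>{1..m}. \<tau> i \<in> BA n) \<and>
    \<phi> = foldl (\<lambda>\<psi> i. \<psi> \<otimes>\<^bsub>GA n\<^esub> \<tau> i \<otimes>\<^bsub>GA n\<^esub> \<alpha> i) (\<alpha> 0) [1..<Suc m])"


section \<open>Normal closures\<close>

definition normal_closure :: "('a, 'b) monoid_scheme \<Rightarrow> 'a set \<Rightarrow> 'a set"
  where "normal_closure G H = \<Inter>{N. N \<lhd> G \<and> H \<subseteq> N}"

definition SLIN :: "nat \<Rightarrow> (nat \<Rightarrow> 'k::comm_ring_1 mpoly) set"
  where "SLIN n = normal_closure (SA n) (SL n)"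

definition normally_cotame :: "nat \<Rightarrow> (nat \<Rightarrow> 'k::comm_ring_1 mpoly) \<Rightarrow> bool"
  where "normally_cotame n \<theta> \<longleftrightarrow> SLIN n \<subseteq> normal_closure (SA n) {\<theta>}"

end

theory Submission
  imports Defs "HOL-Computational_Algebra.Polynomial"
begin

text \<open>Let \<open>N\<close> be a normal subgroup of \<open>SA n\<close>. If some nontrivial element of \<open>N\<close> commutes with a
  nontrivial translation, then \<open>N\<close> contains a nontrivial automorphism changing a single coordinate
  \<open>x\<^sub>i\<close> by a polynomial in the other ones; commutators with translations lower the degree of that
  polynomial, so \<open>N\<close> contains a translation, then all transvections, and hence \<open>SL n\<close>.

  Otherwise taking commutators with conjugates of nontrivial translations never kills a nontrivial
  element of \<open>N\<close>. Starting with a product of four triangular automorphisms in \<open>N\<close>, two such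
  commutators lead to \<open>[\<sigma>, \<alpha>\<^sup>-\<^sup>1 \<pi> \<alpha>]\<close>, where \<open>\<sigma>\<close> and \<open>\<pi>\<close> are conjugates of translations by triangular
  automorphisms and \<open>\<sigma>\<close> commutes with the translations \<open>g\<close> along the last axis. A further commutator
  with \<open>g\<close> replaces \<open>\<pi>\<close> by \<open>\<pi>\<^sup>-\<^sup>1 k \<pi>\<close>, where \<open>k = \<alpha> g \<alpha>\<^sup>-\<^sup>1\<close> is a translation. Since \<open>\<pi>\<close> is unipotent
  triangular, the iterates of this operation become equal to \<open>k\<close>, coordinate by coordinate. But for
  \<open>\<pi> = k\<close> the commutator is \<open>[\<sigma>, g] = 1\<close>, a contradiction.\<close>

section \<open>A commutator argument in normal subgroups\<close>

context group
begin

definition comm :: "'a \<Rightarrow> 'a \<Rightarrow> 'a"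
  where "comm x y = x \<otimes> y \<otimes> inv x \<otimes> inv y"

lemma comm_closed [simp]: "x \<in> carrier G \<Longrightarrow> y \<in> carrier G \<Longrightarrow> comm x y \<in> carrier G"
  by (simp add: comm_def)

lemma cancel_inv_left [simp]: "x \<in> carrier G \<Longrightarrow> y \<in> carrier G \<Longrightarrow> inv x \<otimes> (x \<otimes> y) = y"
  and cancel_left_inv [simp]: "x \<in> carrier G \<Longrightarrow> y \<in> carrier G \<Longrightarrow> x \<otimes> (inv x \<otimes> y) = y"
  by (simp_all flip: m_assoc)

lemma comm_eq_one_iff:
  assumes "x \<in> carrier G" "y \<in> carrier G"
  shows "comm x y = \<one> \<longleftrightarrow> x \<otimes> y = y \<otimes> x"
proof -
  have "comm x y = \<one> \<longleftrightarrow> x \<otimes> y \<otimes> inv x = y"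
    using assms by (auto simp: comm_def inv_solve_right')
  also have "\<dots> \<longleftrightarrow> x \<otimes> y = y \<otimes> x"
    using assms by (auto simp: inv_solve_right')
  finally show ?thesis .
qed

lemma conj_eq_one_iff:
  assumes "x \<in> carrier G" "s \<in> carrier G"
  shows "s \<otimes> x \<otimes> inv s = \<one> \<longleftrightarrow> x = \<one>"
proof -
  have "s \<otimes> x \<otimes> inv s = \<one> \<longleftrightarrow> s \<otimes> x = s"
    using assms by (simp add: inv_solve_right')
  then show ?thesis using assms by simp
qed

lemma comm_mult_commuting:
  assumes "x \<in> carrier G" "r \<in> carrier G" "h \<in> carrier G" "r \<otimes> h = h \<otimes> r"
  shows "comm (x \<otimes> r) h = comm x h"
proof -
  have "r \<otimes> (h \<otimes> z) = h \<otimes> (r \<otimes> z)" if "z \<in> carrier G" for z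
    using assms that by (simp flip: m_assoc)
  then show ?thesis
    using assms by (simp add: comm_def inv_mult_group m_assoc)
qed

text \<open>Since \<open>s\<close> commutes with \<open>g\<close>, the factor
  \<open>inv s \<otimes> g \<otimes> s\<close> in the middle of the commutator collapses to
  \<open>g\<close>. This is one round of the descent: \<open>s\<close> is kept while
  \<open>p\<close> is replaced by a conjugate of \<open>g\<close>.\<close>

lemma comm_inverse_comm:
  assumes "s \<in> carrier G" "p \<in> carrier G" "g \<in> carrier G" "s \<otimes> g = g \<otimes> s"
  shows "inv p \<otimes> comm (inv (comm s p)) g \<otimes> p = comm s (inv p \<otimes> g \<otimes> p)"
proof -
  have "inv s \<otimes> (g \<otimes> (s \<otimes> z)) = g \<otimes> z" if "z \<in> carrier G" for z
  proof -
    have "g \<otimes> (s \<otimes> z) = s \<otimes> (g \<otimes> z)" using assms that by (simp flip: m_assoc)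
    then show ?thesis using assms that by simp
  qed
  then show ?thesis
    using assms by (simp add: comm_def inv_mult_group m_assoc)
qed

lemma conj_commute:
  assumes "b \<in> carrier G" "g \<in> carrier G" "v \<in> carrier G"
    and "(inv b \<otimes> g \<otimes> b) \<otimes> v = v \<otimes> (inv b \<otimes> g \<otimes> b)"
  shows "(b \<otimes> v \<otimes> inv b) \<otimes> g = g \<otimes> (b \<otimes> v \<otimes> inv b)"
proof -
  have "b \<otimes> (v \<otimes> (inv b \<otimes> g \<otimes> b)) \<otimes> inv b = b \<otimes> ((inv b \<otimes> g \<otimes> b) \<otimes> v) \<otimes> inv b"
    by (simp only: assms(4))
  then show ?thesis using assms(1-3) by (simp add: m_assoc)
qed

end

section \<open>Commutators inside a normal subgroup\<close>

context normal
begin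

lemma conj_mem_iff:
  assumes "x \<in> carrier G" "s \<in> carrier G"
  shows "s \<otimes> x \<otimes> inv s \<in> H \<longleftrightarrow> x \<in> H"
proof
  assume "s \<otimes> x \<otimes> inv s \<in> H"
  then have "inv s \<otimes> (s \<otimes> x \<otimes> inv s) \<otimes> s \<in> H"
    using assms inv_op_closed1 by blast
  then show "x \<in> H" using assms by (simp add: m_assoc)
qed (use assms inv_op_closed2 in blast)

lemma comm_mem:
  assumes "x \<in> H" "y \<in> carrier G"
  shows "comm x y \<in> H"
proof -
  have "comm x y = x \<otimes> (y \<otimes> inv x \<otimes> inv y)"
    using assms by (simp add: comm_def m_assoc)
  then show ?thesis using assms by (simp add: inv_op_closed2)
qed

text \<open>\<open>T\<close> stands for the translations, \<open>K\<close> for those along the last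
  axis, \<open>A\<close> for the affine and \<open>B\<close> for the triangular automorphisms.
  \<open>A\<close> preserves \<open>T\<close> under conjugation but \<open>B\<close> only preserves
  \<open>K\<close>, which is why \<open>g\<close> is taken from \<open>K\<close>.\<close>

lemma four_fold_product_trivial:
  assumes T: "T \<subseteq> carrier G" and T_comm: "\<And>s t. s \<in> T \<Longrightarrow> t \<in> T \<Longrightarrow> s \<otimes> t = t \<otimes> s"
    and A: "A \<subseteq> carrier G" "\<And>a t. a \<in> A \<Longrightarrow> t \<in> T \<Longrightarrow> a \<otimes> t \<otimes> inv a \<in> T \<and> inv a \<otimes> t \<otimes> a \<in> T"
    and B: "B \<subseteq> carrier G" "\<And>b t. b \<in> B \<Longrightarrow> t \<in> K \<Longrightarrow> b \<otimes> t \<otimes> inv b \<in> K \<and> inv b \<otimes> t \<otimes> b \<in> K"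
    and K: "K \<subseteq> T" "g \<in> K" "g \<noteq> \<one>"
    and stabilize: "\<And>b h k. b \<in> B \<Longrightarrow> h \<in> T \<Longrightarrow> k \<in> T \<Longrightarrow>
      \<exists>j. ((\<lambda>p. inv p \<otimes> k \<otimes> p) ^^ j) (inv b \<otimes> h \<otimes> b) = k"
    and no_commuting: "\<And>x t. x \<in> H \<Longrightarrow> t \<in> T \<Longrightarrow> x \<otimes> t = t \<otimes> x \<Longrightarrow> x = \<one> \<or> t = \<one>"
    and a: "a\<^sub>0 \<in> A" "a\<^sub>1 \<in> A" "a\<^sub>2 \<in> A" "a\<^sub>3 \<in> A" "a\<^sub>4 \<in> A"
    and b: "b\<^sub>1 \<in> B" "b\<^sub>2 \<in> B" "b\<^sub>3 \<in> B" "b\<^sub>4 \<in> B"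
    and \<theta>: "\<theta> = a\<^sub>0 \<otimes> b\<^sub>1 \<otimes> a\<^sub>1 \<otimes> b\<^sub>2 \<otimes> a\<^sub>2 \<otimes> b\<^sub>3 \<otimes> a\<^sub>3 \<otimes> b\<^sub>4 \<otimes> a\<^sub>4" "\<theta> \<in> H"
  shows "\<theta> = \<one>"
proof (rule ccontr)
  assume "\<theta> \<noteq> \<one>"
  \<comment> \<open>Conjugation, inversion and commutators with nontrivial elements of
    \<open>T\<close> all stay in \<open>H'\<close>, so membership in \<open>H'\<close> carries the
    nontriviality through every step up to the contradiction.\<close>
  define H' where "H' = H - {\<one>}"
  have H'_inv: "inv x \<in> H'" if "x \<in> H'" for x
    using that by (auto simp: H'_def)
  have H'_conj: "s \<otimes> x \<otimes> inv s \<in> H' \<longleftrightarrow> x \<in> H'" if "x \<in> carrier G" "s \<in> carrier G" for x s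
    using that by (simp add: H'_def conj_mem_iff conj_eq_one_iff)
  have H'_comm: "comm x t \<in> H'" if "x \<in> H'" "t \<in> T" "t \<noteq> \<one>" for x t
  proof -
    have "x \<in> H" "x \<in> carrier G" "t \<in> carrier G" using that T by (auto simp: H'_def)
    then show ?thesis
      using that no_commuting[of x t] by (auto simp: H'_def comm_mem comm_eq_one_iff)
  qed
  have G: "a\<^sub>0 \<in> carrier G" "a\<^sub>1 \<in> carrier G" "a\<^sub>2 \<in> carrier G" "a\<^sub>3 \<in> carrier G" "a\<^sub>4 \<in> carrier G"
    "b\<^sub>1 \<in> carrier G" "b\<^sub>2 \<in> carrier G" "b\<^sub>3 \<in> carrier G" "b\<^sub>4 \<in> carrier G" "g \<in> carrier G"
    using a b A(1) B(1) K T by auto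
  \<comment> \<open>The outer factors are absorbed: conjugation by \<open>b\<^sub>4\<close> keeps
    \<open>g\<close> in \<open>K\<close>, and \<open>a\<^sub>3\<close> then keeps it in
    \<open>T\<close>; on the other side \<open>a\<^sub>4\<close> and \<open>a\<^sub>0\<close> are
    both affine and keep it in \<open>T\<close>.\<close>
  define v where "v = a\<^sub>3 \<otimes> (b\<^sub>4 \<otimes> g \<otimes> inv b\<^sub>4) \<otimes> inv a\<^sub>3"
  define w where "w = inv a\<^sub>0 \<otimes> (inv a\<^sub>4 \<otimes> g \<otimes> a\<^sub>4) \<otimes> a\<^sub>0"
  define h where "h = inv a\<^sub>1 \<otimes> g \<otimes> a\<^sub>1"
  define k where "k = a\<^sub>2 \<otimes> g \<otimes> inv a\<^sub>2"
  have vT: "v \<in> T" unfolding v_def using A(2) B(2) a b K by blast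
  have wT: "w \<in> T" unfolding w_def using A(2) a K by blast
  have hT: "h \<in> T" unfolding h_def using A(2) a K by blast
  have kT: "k \<in> T" unfolding k_def using A(2) a K by blast
  have vwh: "v \<in> carrier G" "w \<in> carrier G" "h \<in> carrier G" "k \<in> carrier G"
    using vT wT hT kT T by auto
  have h1: "h \<noteq> \<one>"
    using conj_eq_one_iff[of g "inv a\<^sub>1"] G K by (simp add: h_def)
  define \<sigma> where "\<sigma> = b\<^sub>3 \<otimes> v \<otimes> inv b\<^sub>3"
  define \<rho> where "\<rho> = inv b\<^sub>1 \<otimes> w \<otimes> b\<^sub>1"
  define R where "R = inv a\<^sub>1 \<otimes> inv \<rho> \<otimes> a\<^sub>1"
  define C where "C = b\<^sub>2 \<otimes> a\<^sub>2 \<otimes> \<sigma> \<otimes> inv a\<^sub>2 \<otimes> inv b\<^sub>2"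
  have G': "\<sigma> \<in> carrier G" "\<rho> \<in> carrier G" "R \<in> carrier G" "C \<in> carrier G"
    using G vwh by (auto simp: \<sigma>_def \<rho>_def R_def C_def)
  \<comment> \<open>The conjugate \<open>inv b\<^sub>3 \<otimes> g \<otimes> b\<^sub>3\<close> lies
    in \<open>K\<close>, hence commutes with \<open>v\<close>; conjugating back by
    \<open>b\<^sub>3\<close> gives the claim. The same argument works for \<open>\<rho>\<close> with
    the inverse of \<open>b\<^sub>1\<close>.\<close>
  have \<sigma>g: "\<sigma> \<otimes> g = g \<otimes> \<sigma>"
    unfolding \<sigma>_def using G vwh vT b K B(2) T_comm by (intro conj_commute) blast+
  have \<rho>g: "\<rho> \<otimes> g = g \<otimes> \<rho>"
    using conj_commute[of "inv b\<^sub>1" g w] G vwh wT b K B(2)[of "b\<^sub>1" g] T_comm[of _ w]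
    by (auto simp: \<rho>_def)
  have "inv \<rho> \<otimes> g = g \<otimes> inv \<rho>"
    using \<rho>g G G' by (metis inv_solve_left inv_solve_right m_assoc m_closed inv_closed)
  then have Rh: "R \<otimes> h = h \<otimes> R"
    using conj_commute[of "inv a\<^sub>1" h "inv \<rho>"] G G' vwh by (simp add: R_def h_def m_assoc)

  have "a\<^sub>4 \<otimes> \<theta> \<otimes> inv a\<^sub>4 \<in> H'"
    using \<theta> \<open>\<theta> \<noteq> \<one>\<close> G by (subst H'_conj) (auto simp: H'_def)
  then have "comm (a\<^sub>4 \<otimes> \<theta> \<otimes> inv a\<^sub>4) g \<in> H'"
    using K by (intro H'_comm) auto
  \<comment> \<open>This conjugation strips the factors to the left of \<open>b\<^sub>2\<close>.
    What remains is \<open>C \<otimes> R\<close>, and the commutator with \<open>h\<close> then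
    eliminates \<open>R\<close>, which commutes with \<open>h\<close>.\<close>
  then have "(b\<^sub>2 \<otimes> inv (a\<^sub>4 \<otimes> a\<^sub>0 \<otimes> b\<^sub>1 \<otimes> a\<^sub>1 \<otimes> b\<^sub>2)) \<otimes> comm (a\<^sub>4 \<otimes> \<theta> \<otimes> inv a\<^sub>4) g \<otimes>
      inv (b\<^sub>2 \<otimes> inv (a\<^sub>4 \<otimes> a\<^sub>0 \<otimes> b\<^sub>1 \<otimes> a\<^sub>1 \<otimes> b\<^sub>2)) \<in> H'"
    using G by (subst H'_conj) (simp_all add: \<theta>(1))
  also have "(b\<^sub>2 \<otimes> inv (a\<^sub>4 \<otimes> a\<^sub>0 \<otimes> b\<^sub>1 \<otimes> a\<^sub>1 \<otimes> b\<^sub>2)) \<otimes> comm (a\<^sub>4 \<otimes> \<theta> \<otimes> inv a\<^sub>4) g \<otimes>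
      inv (b\<^sub>2 \<otimes> inv (a\<^sub>4 \<otimes> a\<^sub>0 \<otimes> b\<^sub>1 \<otimes> a\<^sub>1 \<otimes> b\<^sub>2)) = C \<otimes> R"
    using G by (simp add: \<theta>(1) C_def R_def \<sigma>_def \<rho>_def v_def w_def comm_def inv_mult_group m_assoc)
  finally have "comm (C \<otimes> R) h \<in> H'"
    using hT h1 by (intro H'_comm) auto
  then have "comm C h \<in> H'"
    using Rh G' vwh by (simp add: comm_mult_commuting)
  then have "inv (b\<^sub>2 \<otimes> a\<^sub>2) \<otimes> comm C h \<otimes> inv (inv (b\<^sub>2 \<otimes> a\<^sub>2)) \<in> H'"
    using G G' vwh by (subst H'_conj) simp_all
  also have "inv (b\<^sub>2 \<otimes> a\<^sub>2) \<otimes> comm C h \<otimes> inv (inv (b\<^sub>2 \<otimes> a\<^sub>2)) =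
      comm \<sigma> (inv a\<^sub>2 \<otimes> (inv b\<^sub>2 \<otimes> h \<otimes> b\<^sub>2) \<otimes> a\<^sub>2)"
    using G G' vwh by (simp add: C_def comm_def inv_mult_group m_assoc)
  finally have start: "comm \<sigma> (inv a\<^sub>2 \<otimes> (inv b\<^sub>2 \<otimes> h \<otimes> b\<^sub>2) \<otimes> a\<^sub>2) \<in> H'" .

  define P where "P = (\<lambda>j. ((\<lambda>p. inv p \<otimes> k \<otimes> p) ^^ j) (inv b\<^sub>2 \<otimes> h \<otimes> b\<^sub>2))"
  have "P j \<in> carrier G \<and> comm \<sigma> (inv a\<^sub>2 \<otimes> P j \<otimes> a\<^sub>2) \<in> H'" for j
  proof (induction j)
    case 0
    then show ?case using start G vwh by (simp add: P_def)
  next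
    case (Suc j)
    have PS: "P (Suc j) = inv (P j) \<otimes> k \<otimes> P j" by (simp add: P_def)
    let ?p = "inv a\<^sub>2 \<otimes> P j \<otimes> a\<^sub>2"
    have p: "?p \<in> carrier G" using Suc G by simp
    have "comm (inv (comm \<sigma> ?p)) g \<in> H'"
      using H'_comm[OF H'_inv, of _ g] Suc K by blast
    then have "inv ?p \<otimes> comm (inv (comm \<sigma> ?p)) g \<otimes> inv (inv ?p) \<in> H'"
      using G G' p by (subst H'_conj) simp_all
    then have "comm \<sigma> (inv ?p \<otimes> g \<otimes> ?p) \<in> H'"
      using p G G' \<sigma>g comm_inverse_comm[of \<sigma> ?p g] by simp
    moreover have "inv ?p \<otimes> g \<otimes> ?p = inv a\<^sub>2 \<otimes> P (Suc j) \<otimes> a\<^sub>2"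
      using G Suc by (simp add: PS k_def inv_mult_group m_assoc)
    ultimately show ?case using Suc vwh by (simp add: PS)
  qed
  moreover obtain j where "P j = k"
    unfolding P_def using stabilize[OF b(2) hT kT] by blast
  ultimately have "comm \<sigma> (inv a\<^sub>2 \<otimes> k \<otimes> a\<^sub>2) \<in> H'" by metis
  \<comment> \<open>\<open>k\<close> was chosen as the conjugate of \<open>g\<close> by
    \<open>a\<^sub>2\<close>, so the stable value of the iteration corresponds to \<open>g\<close>
    itself, with which \<open>\<sigma>\<close> commutes.\<close>
  also have "inv a\<^sub>2 \<otimes> k \<otimes> a\<^sub>2 = g"
    using G by (simp add: k_def m_assoc)
  finally show False
    using \<sigma>g G G' comm_eq_one_iff[of \<sigma> g] by (simp add: H'_def)
qed

end


section \<open>Polynomials and substitution\<close>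

text \<open>Arbitrary variable sets are allowed so that independence of one variable can be written
  \<open>supported (- {i})\<close>; \<open>polys n\<close> is the case
  \<open>{..<n}\<close>.\<close>

definition supported :: "nat set \<Rightarrow> 'k::zero mpoly set"
  where "supported V = {p. \<forall>m\<in>Poly_Mapping.keys p. Poly_Mapping.keys m \<subseteq> V}"

definition monomial_subst :: "(nat \<Rightarrow> 'k::comm_ring_1 mpoly) \<Rightarrow> (nat \<Rightarrow>\<^sub>0 nat) \<Rightarrow> 'k mpoly"
  where "monomial_subst H m = (\<Prod>i\<in>Poly_Mapping.keys m. H i ^ Poly_Mapping.lookup m i)"

lemma polys_eq_supported: "polys n = supported {..<n}"
  by (simp add: polys_def supported_def)

lemma supported_mono: "V \<subseteq> W \<Longrightarrow> p \<in> supported V \<Longrightarrow> p \<in> supported W"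
  by (auto simp: supported_def)

lemma supported_Int: "p \<in> supported V \<Longrightarrow> p \<in> supported W \<Longrightarrow> p \<in> supported (V \<inter> W)"
  by (auto simp: supported_def)

lemma Const_0 [simp]: "Const 0 = 0"
  and Const_1 [simp]: "Const 1 = 1"
  and Const_add: "Const (a + b) = Const a + Const b"
  and Const_uminus: "Const (- b') = - Const b'"
  and Const_mult: "Const (c * d) = Const c * Const d"
  for a b :: "'a::comm_monoid_add" and b' :: "'b::ab_group_add" and c d :: "'c::semiring_0"
  by (simp_all add: Const_def single_add single_uminus mult_single)

lemma Const_eq_iff [simp]: "Const a = Const b \<longleftrightarrow> a = b"
  by (auto simp: Const_def dest: injD[OF inj_single])

lemma Const_eq_0_iff [simp]: "Const a = 0 \<longleftrightarrow> a = 0"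
  by (metis Const_0 Const_eq_iff)

lemma Const_eq_1_iff [simp]: "Const a = 1 \<longleftrightarrow> a = 1"
  by (metis Const_1 Const_eq_iff)

lemma Const_sum: "Const (\<Sum>i\<in>A. f i) = (\<Sum>i\<in>A. Const (f i :: 'a::comm_monoid_add))"
  by (induction A rule: infinite_finite_induct) (auto simp: Const_add)

lemma Const_prod: "Const (\<Prod>i\<in>A. f i) = (\<Prod>i\<in>A. Const (f i :: 'a::comm_semiring_1))"
  by (induction A rule: infinite_finite_induct) (auto simp: Const_mult)

lemma Const_supported [simp]: "Const c \<in> supported V"
  by (auto simp: Const_def supported_def)

lemma zero_supported [simp]: "0 \<in> supported V" and one_supported [simp]: "1 \<in> supported V"
  by (auto simp: supported_def)

lemma Var_supported [simp]: "Var i \<in> supported V \<longleftrightarrow> i \<in> V"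
  by (auto simp: Var_def supported_def)

lemma add_supported [simp]: "p \<in> supported V \<Longrightarrow> q \<in> supported V \<Longrightarrow> p + q \<in> supported V"
  using keys_add[of p q] by (auto simp: supported_def)

lemma uminus_supported [simp]:
  "(p::'k::ab_group_add mpoly) \<in> supported V \<Longrightarrow> - p \<in> supported V"
  by (auto simp: supported_def in_keys_iff)

lemma diff_supported [simp]:
  "(p::'k::ab_group_add mpoly) \<in> supported V \<Longrightarrow> q \<in> supported V \<Longrightarrow> p - q \<in> supported V"
  using add_supported[of p V "- q"] by simp

lemma keys_add_nat: "Poly_Mapping.keys (m + m') = Poly_Mapping.keys m \<union> Poly_Mapping.keys m'"
  for m m' :: "'a \<Rightarrow>\<^sub>0 nat"
  by (auto simp: in_keys_iff lookup_add)

lemma mult_supported [simp]: "p \<in> supported V \<Longrightarrow> q \<in> supported V \<Longrightarrow> p * q \<in> supported V"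
  using keys_mult[of p q] by (fastforce simp: supported_def keys_add_nat)

lemma sum_supported [simp]: "(\<And>i. i \<in> A \<Longrightarrow> f i \<in> supported V) \<Longrightarrow> sum f A \<in> supported V"
  by (induction A rule: infinite_finite_induct) auto

lemma supported_empty:
  assumes "p \<in> supported {}" shows "\<exists>c. p = Const c"
proof -
  have "Poly_Mapping.keys p \<subseteq> {0}"
    using assms by (auto simp: supported_def)
  then have "p = Const (Poly_Mapping.lookup p 0)"
    unfolding Const_def by (intro poly_mapping_eqI) (auto simp: lookup_single when_def in_keys_iff)
  then show ?thesis ..
qed

section \<open>Decomposition into monomials and the substitution homomorphism\<close>

lemma sum_singles:
  "(\<Sum>m\<in>Poly_Mapping.keys p. Poly_Mapping.single m (Poly_Mapping.lookup p m)) = p"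
  by (rule poly_mapping_eqI) (simp add: lookup_sum lookup_single when_def in_keys_iff)

text \<open>Additive induction along the monomials of one fixed \<open>p\<close>. The case
  \<open>single\<close> keeps \<open>m \<in> keys p\<close>, so support and degree bounds on
  \<open>p\<close> remain available for each monomial.\<close>

lemma single_induct [case_names zero single add]:
  fixes p :: "'a \<Rightarrow>\<^sub>0 'b::comm_monoid_add"
  assumes "Q 0" and "\<And>m c. m \<in> Poly_Mapping.keys p \<Longrightarrow> Q (Poly_Mapping.single m c)"
    and "\<And>p q. Q p \<Longrightarrow> Q q \<Longrightarrow> Q (p + q)"
  shows "Q p"
proof -
  have "Q (\<Sum>m\<in>A. Poly_Mapping.single m (Poly_Mapping.lookup p m))"
    if "finite A" "A \<subseteq> Poly_Mapping.keys p" for A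
    using that by (induction A rule: finite_induct) (auto intro: assms)
  from this[of "Poly_Mapping.keys p"] show ?thesis by (simp add: sum_singles)
qed

lemma monomial_subst_superset:
  assumes "finite S" "Poly_Mapping.keys m \<subseteq> S"
  shows "monomial_subst H m = (\<Prod>i\<in>S. H i ^ Poly_Mapping.lookup m i)"
  unfolding monomial_subst_def using assms
  by (intro prod.mono_neutral_left) (auto simp: in_keys_iff)

lemma monomial_subst_0 [simp]: "monomial_subst H 0 = 1"
  by (simp add: monomial_subst_def)

lemma monomial_subst_add: "monomial_subst H (m + m') = monomial_subst H m * monomial_subst H m'"
proof -
  let ?S = "Poly_Mapping.keys m \<union> Poly_Mapping.keys m'"
  have *: "monomial_subst H u = (\<Prod>i\<in>?S. H i ^ Poly_Mapping.lookup u i)"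
    if "Poly_Mapping.keys u \<subseteq> ?S" for u
    using that by (intro monomial_subst_superset) auto
  show ?thesis
    by (subst (1 2 3) *) (auto simp: keys_add_nat lookup_add power_add prod.distrib)
qed

lemma psubst_superset:
  assumes "finite S" "Poly_Mapping.keys p \<subseteq> S"
  shows "psubst H p = (\<Sum>m\<in>S. Const (Poly_Mapping.lookup p m) * monomial_subst H m)"
  unfolding psubst_def monomial_subst_def[symmetric] using assms
  by (intro sum.mono_neutral_left) (auto simp: in_keys_iff)

lemma psubst_0 [simp]: "psubst H 0 = 0"
  by (simp add: psubst_def)

lemma psubst_add [simp]: "psubst H (p + q) = psubst H p + psubst H q"
proof -
  let ?S = "Poly_Mapping.keys p \<union> Poly_Mapping.keys q"
  have *: "psubst H u = (\<Sum>m\<in>?S. Const (Poly_Mapping.lookup u m) * monomial_subst H m)"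
    if "Poly_Mapping.keys u \<subseteq> ?S" for u
    using that by (intro psubst_superset) auto
  show ?thesis
    using keys_add[of p q]
    by (subst (1 2 3) *) (auto simp: lookup_add Const_add sum.distrib algebra_simps)
qed

lemma psubst_single: "psubst H (Poly_Mapping.single m c) = Const c * monomial_subst H m"
  by (subst psubst_superset[of "{m}"]) auto

lemma psubst_Const [simp]: "psubst H (Const c) = Const c"
  by (simp add: psubst_single Const_def)

lemma psubst_1 [simp]: "psubst H 1 = 1"
  using psubst_Const[of H 1] by simp

lemma psubst_Var [simp]: "psubst H (Var i) = H i"
  by (simp add: psubst_single Var_def monomial_subst_def)

lemma psubst_mult [simp]: "psubst H (p * q) = psubst H p * psubst H q"
proof (induction p rule: single_induct)
  case (single m c)
  show ?case
    by (induction q rule: single_induct)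
      (auto simp: mult_single psubst_single monomial_subst_add Const_mult algebra_simps)
qed (auto simp: algebra_simps)

lemma psubst_uminus [simp]: "psubst H (- p) = - psubst H p"
  using psubst_add[of H p "- p"] by (simp add: eq_neg_iff_add_eq_0 add.commute)

lemma psubst_diff [simp]: "psubst H (p - q) = psubst H p - psubst H q"
  using psubst_add[of H p "- q"] by simp

lemma psubst_sum [simp]: "psubst H (\<Sum>i\<in>A. f i) = (\<Sum>i\<in>A. psubst H (f i))"
  by (induction A rule: infinite_finite_induct) auto

lemma single_eq_psubst_Var: "Poly_Mapping.single m c = Const c * monomial_subst Var m"
proof -
  have *: "(Var i ^ k :: 'a mpoly) = Poly_Mapping.single (Poly_Mapping.single i k) 1" for i k
    by (induction k) (auto simp: Var_def mult_single single_add[symmetric])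
  have "(\<Prod>i\<in>S. Poly_Mapping.single (Poly_Mapping.single i (f i)) (1::'a)) =
     Poly_Mapping.single (\<Sum>i\<in>S. Poly_Mapping.single i (f i)) 1" for S and f :: "nat \<Rightarrow> nat"
    by (induction S rule: infinite_finite_induct) (auto simp: mult_single)
  then have "monomial_subst Var m = Poly_Mapping.single m (1::'a)"
    by (simp add: monomial_subst_def * sum_singles)
  then show ?thesis by (simp add: Const_def mult_single)
qed

text \<open>Each monomial of \<open>p\<close> is a constant times a product of variables from
  \<open>V\<close>, so sums and products reach \<open>p\<close>. Identities between ring
  homomorphisms such as \<open>psubst\<close> then need checking only on constants and
  variables.\<close>

lemma supported_induct [consumes 1, case_names Const Var add mult]:
  fixes p :: "'k::comm_ring_1 mpoly"
  assumes p: "p \<in> supported V"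
    and Const: "\<And>c. Q (Const c)" and Var: "\<And>i. i \<in> V \<Longrightarrow> Q (Var i)"
    and add: "\<And>p q. Q p \<Longrightarrow> Q q \<Longrightarrow> Q (p + q)" and mult: "\<And>p q. Q p \<Longrightarrow> Q q \<Longrightarrow> Q (p * q)"
  shows "Q p"
proof (induction p rule: single_induct)
  case zero
  then show ?case using Const[of 0] by simp
next
  case (single m c)
  have pow: "Q (q ^ k)" if "Q q" for q k
    using that Const[of 1] by (induction k) (auto intro: mult)
  have "Q (\<Prod>i\<in>A. f i)" if "\<And>i. i \<in> A \<Longrightarrow> Q (f i)" for A :: "nat set" and f
    using that Const[of 1] by (induction A rule: infinite_finite_induct) (auto intro: mult)
  moreover have "Q (Var i ^ Poly_Mapping.lookup m i)" if "i \<in> Poly_Mapping.keys m" for i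
    using that single p by (intro pow Var) (auto simp: supported_def)
  ultimately have "Q (monomial_subst Var m)"
    unfolding monomial_subst_def by simp
  then show ?case by (simp add: single_eq_psubst_Var mult Const)
qed (rule add)

lemma supported_UNIV [simp]: "p \<in> supported UNIV"
  by (simp add: supported_def)

lemma psubst_Var_id [simp]: "psubst Var p = p"
  by (rule supported_induct[OF supported_UNIV]) auto

lemma psubst_psubst: "psubst F (psubst H p) = psubst (\<lambda>i. psubst F (H i)) p"
  by (rule supported_induct[OF supported_UNIV]) auto

lemma psubst_cong: "p \<in> supported V \<Longrightarrow> (\<And>i. i \<in> V \<Longrightarrow> F i = H i) \<Longrightarrow> psubst F p = psubst H p"
  by (induction rule: supported_induct) auto

lemma psubst_supported:
  "p \<in> supported V \<Longrightarrow> (\<And>i. i \<in> V \<Longrightarrow> H i \<in> supported W) \<Longrightarrow> psubst H p \<in> supported W"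
  by (induction rule: supported_induct) auto


section \<open>Translations lower degrees\<close>

definition monomial_degree :: "(nat \<Rightarrow>\<^sub>0 nat) \<Rightarrow> nat"
  where "monomial_degree m = (\<Sum>i\<in>Poly_Mapping.keys m. Poly_Mapping.lookup m i)"

text \<open>The bound is strict, so \<open>degree_below 0\<close> contains exactly the zero
  polynomial and \<open>degree_below 1\<close> the constants; the zero polynomial needs no degree of
  its own.\<close>

definition degree_below :: "nat \<Rightarrow> 'k::zero mpoly set"
  where "degree_below d = {p. \<forall>m\<in>Poly_Mapping.keys p. monomial_degree m < d}"

definition shift :: "(nat \<Rightarrow> 'k) \<Rightarrow> 'k::comm_ring_1 mpoly \<Rightarrow> 'k mpoly"
  where "shift v p = psubst (\<lambda>i. Var i + Const (v i)) p"

lemma monomial_degree_add: "monomial_degree (m + m') = monomial_degree m + monomial_degree m'"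
proof -
  let ?S = "Poly_Mapping.keys m \<union> Poly_Mapping.keys m'"
  have *: "monomial_degree u = (\<Sum>i\<in>?S. Poly_Mapping.lookup u i)"
    if "Poly_Mapping.keys u \<subseteq> ?S" for u
    unfolding monomial_degree_def using that
    by (intro sum.mono_neutral_left) (auto simp: in_keys_iff)
  show ?thesis
    by (subst (1 2 3) *) (auto simp: keys_add_nat lookup_add sum.distrib)
qed

lemma degree_below_0: "p \<in> degree_below 0 \<longleftrightarrow> p = 0"
  by (auto simp: degree_below_def)

lemma degree_below_mono: "d \<le> e \<Longrightarrow> p \<in> degree_below d \<Longrightarrow> p \<in> degree_below e"
  by (fastforce simp: degree_below_def)

lemma degree_below_exists: "\<exists>d. p \<in> degree_below d"
proof -
  have "\<forall>m\<in>Poly_Mapping.keys p. monomial_degree m < Suc (Max (monomial_degree ` Poly_Mapping.keys p))"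
    by (auto simp: less_Suc_eq_le)
  then show ?thesis unfolding degree_below_def by blast
qed

lemma degree_below_add [simp]:
  "p \<in> degree_below d \<Longrightarrow> q \<in> degree_below d \<Longrightarrow> p + q \<in> degree_below d"
  using keys_add[of p q] by (auto simp: degree_below_def)

lemma degree_below_diff:
  fixes p :: "'k::ab_group_add mpoly"
  shows "p \<in> degree_below d \<Longrightarrow> q \<in> degree_below d \<Longrightarrow> p - q \<in> degree_below d"
  using degree_below_add[of p d "- q"] by (auto simp: degree_below_def in_keys_iff)

lemma degree_below_mult:
  assumes "p \<in> degree_below a" "q \<in> degree_below b"
  shows "p * q \<in> degree_below (a + b - 1)"
  unfolding degree_below_def
proof (intro CollectI ballI)
  fix m assume "m \<in> Poly_Mapping.keys (p * q)"
  then obtain u w where "m = u + w" "u \<in> Poly_Mapping.keys p" "w \<in> Poly_Mapping.keys q"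
    using keys_mult[of p q] by blast
  moreover from this have "monomial_degree u < a" "monomial_degree w < b"
    using assms by (auto simp: degree_below_def)
  ultimately show "monomial_degree m < a + b - 1"
    by (simp add: monomial_degree_add)
qed

lemma degree_below_0I [simp]: "0 \<in> degree_below d"
  by (simp add: degree_below_def)

lemma Const_degree_below: "Const c \<in> degree_below (Suc 0)"
  by (auto simp: degree_below_def Const_def monomial_degree_def)

lemma degree_below_1: "p \<in> degree_below (Suc 0) \<Longrightarrow> \<exists>c. p = Const c"
  by (intro supported_empty)
    (auto simp del: keys_eq_empty simp: degree_below_def supported_def monomial_degree_def)

text \<open>Discrete Leibniz rule: the difference of a product is the difference of \<open>p\<close>
  times the shifted \<open>q\<close>, plus \<open>p\<close> times the difference of
  \<open>q\<close>. Both summands lose one degree.\<close>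

lemma shift_mult_degree:
  assumes "p \<in> degree_below (Suc a)" "shift v p - p \<in> degree_below a"
    and "q \<in> degree_below (Suc b)" "shift v q - q \<in> degree_below b"
  shows "p * q \<in> degree_below (Suc (a + b))" "shift v (p * q) - p * q \<in> degree_below (a + b)"
proof -
  show "p * q \<in> degree_below (Suc (a + b))"
    using degree_below_mult[OF assms(1,3)] by simp
  have "shift v q \<in> degree_below (Suc b)"
    using degree_below_add[OF assms(3) degree_below_mono[OF _ assms(4)]] by simp
  then have "(shift v p - p) * shift v q + p * (shift v q - q) \<in> degree_below (a + b)"
    using degree_below_mult[OF assms(2), of "shift v q" "Suc b"] degree_below_mult[OF assms(1,4)]
    by auto
  then show "shift v (p * q) - p * q \<in> degree_below (a + b)"
    by (simp add: shift_def algebra_simps)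
qed

text \<open>Taking the difference is additive, so monomials suffice. A variable has a constant
  difference and a constant has difference 0; the Leibniz rule passes to powers and then to products
  of powers.\<close>

lemma shift_diff_degree:
  fixes p :: "'k::comm_ring_1 mpoly"
  assumes "p \<in> degree_below (Suc d)"
  shows "shift v p - p \<in> degree_below d"
proof (rule single_induct[where p = p])
  fix m c
  assume m: "m \<in> Poly_Mapping.keys p"
  let ?R = "\<lambda>k p. p \<in> degree_below (Suc k) \<and> shift v p - p \<in> degree_below k"
  have C: "?R 0 (Const c)" for c
    by (simp add: shift_def Const_degree_below)
  have "?R 1 (Var i)" for i
    using Const_degree_below[of "v i"] by (simp add: shift_def) (simp add: degree_below_def monomial_degree_def Var_def)
  then have V: "(Var i :: 'k mpoly) \<in> degree_below (Suc 1)" "shift v (Var i) - Var i \<in> degree_below 1" for i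
    by blast+
  have pow: "?R k (Var i ^ k)" for i k
  proof (induction k)
    case (Suc k)
    then show ?case using shift_mult_degree[OF V, of "Var i ^ k" k i] by simp
  qed (use C[of 1] in simp)
  have "?R (\<Sum>i\<in>A. k i) (\<Prod>i\<in>A. Var i ^ k i)" for A :: "nat set" and k
  proof (induction A rule: infinite_finite_induct)
    case (insert x F)
    then show ?case
      using pow[of x "k x"] shift_mult_degree[of "Var x ^ k x" "k x" v "\<Prod>i\<in>F. Var i ^ k i" "sum k F"]
      by simp
  qed (use C[of 1] in auto)
  then have "?R (monomial_degree m) (monomial_subst Var m)"
    by (simp add: monomial_degree_def monomial_subst_def)
  then have "?R (monomial_degree m) (Const c * monomial_subst Var m)"
    using C[of c] shift_mult_degree[of "Const c" 0 v "monomial_subst Var m" "monomial_degree m"] by simp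
  then have "shift v (Poly_Mapping.single m c) - Poly_Mapping.single m c \<in> degree_below (monomial_degree m)"
    by (simp add: single_eq_psubst_Var)
  moreover have "monomial_degree m \<le> d"
    using m assms by (auto simp: degree_below_def)
  ultimately show "shift v (Poly_Mapping.single m c) - Poly_Mapping.single m c \<in> degree_below d"
    using degree_below_mono by blast
next
  fix p q assume "shift v p - p \<in> degree_below d" "shift v q - q \<in> degree_below d"
  then have "(shift v p - p) + (shift v q - q) \<in> degree_below d" by (rule degree_below_add)
  then show "shift v (p + q) - (p + q) \<in> degree_below d" by (simp add: shift_def algebra_simps)
qed (simp add: shift_def)


text \<open>\<open>p(x\<^sub>i + r)\<close> is a polynomial in \<open>r\<close> with value \<open>p\<close> at infinitely many \<open>r\<close>, hence also at
  \<open>r = - x\<^sub>i\<close>.\<close>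

lemma shift_invariant_supported:
  fixes p :: "'k::field_char_0 mpoly"
  assumes inv: "shift (\<lambda>j. if j = i then c else 0) p = p" and "c \<noteq> 0"
  shows "p \<in> supported (- {i})"
proof -
  define F :: "'k mpoly \<Rightarrow> nat \<Rightarrow> 'k mpoly" where "F r = (\<lambda>j. if j = i then Var j + r else Var j)" for r
  have "\<exists>q. \<forall>r. poly q r = psubst (F r) p"
  proof (induction rule: supported_induct[OF supported_UNIV[of p]])
    case (1 c)
    show ?case by (rule exI[of _ "[:Const c:]"]) simp
  next
    case (2 j)
    show ?case
      by (rule exI[of _ "if j = i then [:Var j, 1:] else [:Var j:]"]) (simp add: F_def)
  next
    case (3 p q)
    then show ?case by (metis poly_add psubst_add)
  next
    case (4 p q)
    then show ?case by (metis poly_mult psubst_mult)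
  qed
  then obtain q where q: "\<And>r. poly q r = psubst (F r) p" by blast
  have eq: "poly q (Const (of_nat k * c)) = p" for k
  proof (induction k)
    case 0
    have "F 0 = Var" by (auto simp: F_def)
    then show ?case by (simp add: q)
  next
    case (Suc k)
    have "psubst (F (Const (of_nat (Suc k) * c))) p =
      shift (\<lambda>j. if j = i then c else 0) (psubst (F (Const (of_nat k * c))) p)"
      unfolding shift_def psubst_psubst
      by (rule arg_cong[of _ _ "\<lambda>H. psubst H p"]) (auto simp: F_def Const_add algebra_simps)
    then show ?case using Suc inv by (simp add: q)
  qed
  have "q - [:p:] = 0"
  proof (rule ccontr)
    assume "q - [:p:] \<noteq> 0"
    then have "finite {r. poly (q - [:p:]) r = 0}" by (rule poly_roots_finite)
    moreover have "range (\<lambda>k. Const (of_nat k * c)) \<subseteq> {r. poly (q - [:p:]) r = 0}"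
      using eq by auto
    \<comment> \<open>Characteristic zero enters here: the multiples of \<open>c\<close> are
      pairwise distinct.\<close>
    moreover have "inj (\<lambda>k. Const (of_nat k * c))"
      using \<open>c \<noteq> 0\<close> by (auto intro!: injI)
    ultimately show False
      using finite_subset infinite_UNIV_nat finite_image_iff by blast
  qed
  then have "poly (q - [:p:]) (- Var i) = 0" by simp
  then have "psubst (F (- Var i)) p = p" by (simp add: q)
  \<comment> \<open>\<open>F (- Var i)\<close> sends \<open>x_i\<close> to
    \<open>x_i - x_i = 0\<close> and fixes the other variables, so its values are free of
    \<open>x_i\<close>.\<close>
  moreover have "psubst (F (- Var i)) p \<in> supported (- {i})"
    by (rule psubst_supported[OF supported_UNIV]) (simp add: F_def)
  ultimately show ?thesis by simp
qed


section \<open>Partial derivatives\<close>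

lemma partial_deriv_superset:
  assumes "finite S" "Poly_Mapping.keys p \<subseteq> S"
  shows "partial_deriv i p = (\<Sum>m\<in>S. Poly_Mapping.single (m - Poly_Mapping.single i 1)
      (of_nat (Poly_Mapping.lookup m i) * Poly_Mapping.lookup p m))"
  unfolding partial_deriv_def using assms
  by (intro sum.mono_neutral_left) (auto simp: in_keys_iff)

lemma partial_deriv_add [simp]: "partial_deriv i (p + q) = partial_deriv i p + partial_deriv i q"
proof -
  let ?S = "Poly_Mapping.keys p \<union> Poly_Mapping.keys q"
  have *: "partial_deriv i u = (\<Sum>m\<in>?S. Poly_Mapping.single (m - Poly_Mapping.single i 1)
      (of_nat (Poly_Mapping.lookup m i) * Poly_Mapping.lookup u m))"
    if "Poly_Mapping.keys u \<subseteq> ?S" for u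
    using that by (intro partial_deriv_superset) auto
  show ?thesis
    using keys_add[of p q]
    by (subst (1 2 3) *) (auto simp: lookup_add single_add sum.distrib algebra_simps)
qed

lemma partial_deriv_0 [simp]: "partial_deriv i 0 = 0"
  by (simp add: partial_deriv_def)

lemma partial_deriv_sum [simp]: "partial_deriv i (\<Sum>j\<in>A. f j) = (\<Sum>j\<in>A. partial_deriv i (f j))"
  by (induction A rule: infinite_finite_induct) auto

lemma partial_deriv_supported: "p \<in> supported V \<Longrightarrow> i \<notin> V \<Longrightarrow> partial_deriv i p = 0"
proof -
  assume "p \<in> supported V" "i \<notin> V"
  then have "Poly_Mapping.lookup m i = 0" if "m \<in> Poly_Mapping.keys p" for m
    using that by (auto simp: supported_def not_in_keys_iff_lookup_eq_zero[symmetric])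
  then show ?thesis by (simp add: partial_deriv_def)
qed

lemma partial_deriv_Const [simp]: "partial_deriv i (Const c) = 0"
  by (rule partial_deriv_supported[of _ "{}"]) auto

lemma partial_deriv_Const_Var [simp]:
  "partial_deriv i (Const a * Var j) = (if i = j then Const a else 0)"
  by (subst partial_deriv_superset[of "{Poly_Mapping.single j 1}"])
    (auto simp: Const_def Var_def mult_single lookup_single when_def)

lemma partial_deriv_Var [simp]:
  "partial_deriv i (Var j) = (if i = j then 1 else (0 :: 'k::comm_ring_1 mpoly))"
  using partial_deriv_Const_Var[of i "1::'k" j] by simp


section \<open>The groups of automorphisms\<close>

abbreviation endos :: "nat \<Rightarrow> (nat \<Rightarrow> 'k::comm_ring_1 mpoly) set"
  where "endos n \<equiv> {..<n} \<rightarrow>\<^sub>E supported {..<n}"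

lemma carrier_poly_endos: "carrier (poly_endos n) = endos n"
  by (simp add: poly_endos_def polys_eq_supported)

lemma mult_poly_endos: "\<phi> \<otimes>\<^bsub>poly_endos n\<^esub> \<psi> = (\<lambda>i\<in>{..<n}. psubst \<psi> (\<phi> i))"
  by (simp add: poly_endos_def)

lemma one_poly_endos: "\<one>\<^bsub>poly_endos n\<^esub> = (\<lambda>i\<in>{..<n}. Var i)"
  by (simp add: poly_endos_def)

lemma psubst_endo_cong:
  "p \<in> supported {..<n} \<Longrightarrow> (\<And>i. i < n \<Longrightarrow> F i = H i) \<Longrightarrow> psubst F p = psubst H p"
  by (rule psubst_cong) auto

lemma psubst_one: "p \<in> supported {..<n} \<Longrightarrow> psubst (\<lambda>i\<in>{..<n}. Var i) p = p"
  using psubst_endo_cong[of p n "\<lambda>i\<in>{..<n}. Var i" Var] by simp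

lemma endos_apply: "\<phi> \<in> endos n \<Longrightarrow> i < n \<Longrightarrow> \<phi> i \<in> supported {..<n}"
  by auto

lemma endo_eqI:
  "\<phi> \<in> extensional {..<n} \<Longrightarrow> \<psi> \<in> extensional {..<n} \<Longrightarrow> (\<And>i. i < n \<Longrightarrow> \<phi> i = \<psi> i) \<Longrightarrow> \<phi> = \<psi>"
  by (rule extensionalityI[of _ "{..<n}"]) auto

lemma comp_endos:
  assumes "\<phi> \<in> endos n" "\<psi> \<in> endos n"
  shows "(\<lambda>i\<in>{..<n}. psubst \<psi> (\<phi> i)) \<in> endos n"
  using assms by (auto intro!: psubst_supported[where V = "{..<n}"])

lemma monoid_poly_endos: "monoid (poly_endos n)"
proof (rule monoidI)
  fix \<phi> \<psi> \<chi> :: "nat \<Rightarrow> 'a mpoly"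
  assume "\<phi> \<in> carrier (poly_endos n)" "\<psi> \<in> carrier (poly_endos n)" "\<chi> \<in> carrier (poly_endos n)"
  then have *: "\<phi> \<in> endos n" "\<psi> \<in> endos n" "\<chi> \<in> endos n"
    by (auto simp: carrier_poly_endos)
  show "\<phi> \<otimes>\<^bsub>poly_endos n\<^esub> \<psi> \<in> carrier (poly_endos n)"
    using * by (simp only: carrier_poly_endos mult_poly_endos comp_endos)
  show "\<phi> \<otimes>\<^bsub>poly_endos n\<^esub> \<psi> \<otimes>\<^bsub>poly_endos n\<^esub> \<chi> =
    \<phi> \<otimes>\<^bsub>poly_endos n\<^esub> (\<psi> \<otimes>\<^bsub>poly_endos n\<^esub> \<chi>)"
  proof (rule endo_eqI[of _ n])
    fix i assume "i < n"
    \<comment> \<open>\<open>\<phi> i\<close> contains only variables below \<open>n\<close>, so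
      substitution does not see the restriction of the composite to \<open>{..<n}\<close>.\<close>
    then have "psubst (\<lambda>i\<in>{..<n}. psubst \<chi> (\<psi> i)) (\<phi> i) = psubst (\<lambda>i. psubst \<chi> (\<psi> i)) (\<phi> i)"
      using * by (intro psubst_endo_cong[of _ n]) auto
    then show "(\<phi> \<otimes>\<^bsub>poly_endos n\<^esub> \<psi> \<otimes>\<^bsub>poly_endos n\<^esub> \<chi>) i =
        (\<phi> \<otimes>\<^bsub>poly_endos n\<^esub> (\<psi> \<otimes>\<^bsub>poly_endos n\<^esub> \<chi>)) i"
      using \<open>i < n\<close> by (simp add: mult_poly_endos psubst_psubst)
  qed (auto simp: mult_poly_endos)
  show "\<one>\<^bsub>poly_endos n\<^esub> \<otimes>\<^bsub>poly_endos n\<^esub> \<phi> = \<phi>"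
    using * by (intro endo_eqI[of _ n]) (auto simp: mult_poly_endos one_poly_endos PiE_def)
  show "\<phi> \<otimes>\<^bsub>poly_endos n\<^esub> \<one>\<^bsub>poly_endos n\<^esub> = \<phi>"
    using * by (intro endo_eqI[of _ n])
      (auto simp: mult_poly_endos one_poly_endos PiE_def intro!: psubst_one)
qed (auto simp: carrier_poly_endos one_poly_endos)

lemma group_GA: "group (GA n)"
  unfolding GA_def by (rule monoid.units_group[OF monoid_poly_endos])

lemma mult_GA: "\<phi> \<otimes>\<^bsub>GA n\<^esub> \<psi> = (\<lambda>i\<in>{..<n}. psubst \<psi> (\<phi> i))"
  and one_GA: "\<one>\<^bsub>GA n\<^esub> = (\<lambda>i\<in>{..<n}. Var i)"
  by (simp_all add: GA_def units_of_def mult_poly_endos one_poly_endos)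

lemma mult_SA: "\<phi> \<otimes>\<^bsub>SA n\<^esub> \<psi> = (\<lambda>i\<in>{..<n}. psubst \<psi> (\<phi> i))"
  and one_SA: "\<one>\<^bsub>SA n\<^esub> = (\<lambda>i\<in>{..<n}. Var i)"
  by (simp_all add: SA_def mult_GA one_GA)

lemma GA_endos: "\<phi> \<in> carrier (GA n) \<Longrightarrow> \<phi> \<in> endos n"
  by (simp add: GA_def units_of_def Units_def carrier_poly_endos)

lemma SA_GA: "\<phi> \<in> carrier (SA n) \<Longrightarrow> \<phi> \<in> carrier (GA n)"
  by (simp add: SA_def)

lemma SA_endos: "\<phi> \<in> carrier (SA n) \<Longrightarrow> \<phi> \<in> endos n"
  by (simp add: SA_GA GA_endos)

lemma GA_I:
  assumes "\<phi> \<in> endos n" "\<psi> \<in> endos n"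
    and "\<And>i. i < n \<Longrightarrow> psubst \<psi> (\<phi> i) = Var i" "\<And>i. i < n \<Longrightarrow> psubst \<phi> (\<psi> i) = Var i"
  shows "\<phi> \<in> carrier (GA n)"
proof -
  have "\<phi> \<otimes>\<^bsub>poly_endos n\<^esub> \<psi> = \<one>\<^bsub>poly_endos n\<^esub>" "\<psi> \<otimes>\<^bsub>poly_endos n\<^esub> \<phi> = \<one>\<^bsub>poly_endos n\<^esub>"
    using assms by (auto simp: mult_poly_endos one_poly_endos)
  then show ?thesis
    using assms(1,2) by (auto simp: GA_def units_of_def Units_def carrier_poly_endos)
qed

lemma SA_I: "\<phi> \<in> carrier (GA n) \<Longrightarrow> det (jacobian n \<phi>) = 1 \<Longrightarrow> \<phi> \<in> carrier (SA n)"
  by (simp add: SA_def)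


section \<open>Elementary automorphisms and translations\<close>

text \<open>When \<open>P\<close> is free of \<open>x_i\<close> this is an automorphism with inverse
  given by \<open>- P\<close>; the lemmas that rely on it assume
  \<open>P \<in> supported ({..<n} - {i})\<close>.\<close>

definition elementary :: "nat \<Rightarrow> nat \<Rightarrow> 'k::comm_ring_1 mpoly \<Rightarrow> nat \<Rightarrow> 'k mpoly"
  where "elementary n i P = (\<lambda>j\<in>{..<n}. if j = i then Var i + P else Var j)"

definition translation :: "nat \<Rightarrow> (nat \<Rightarrow> 'k) \<Rightarrow> nat \<Rightarrow> 'k::comm_ring_1 mpoly"
  where "translation n v = (\<lambda>i\<in>{..<n}. Var i + Const (v i))"

lemma psubst_translation: "p \<in> supported {..<n} \<Longrightarrow> psubst (translation n v) p = shift v p"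
  unfolding shift_def by (rule psubst_endo_cong) (auto simp: translation_def)

lemma translation_mult: "translation n v \<otimes>\<^bsub>SA n\<^esub> \<phi> = (\<lambda>i\<in>{..<n}. \<phi> i + Const (v i))"
  by (rule ext) (simp add: mult_SA translation_def)

lemma mult_translation:
  "\<phi> \<in> endos n \<Longrightarrow> \<phi> \<otimes>\<^bsub>SA n\<^esub> translation n v = (\<lambda>i\<in>{..<n}. shift v (\<phi> i))"
  by (rule endo_eqI) (auto simp: mult_SA intro!: psubst_translation)

lemma translation_endos: "translation n v \<in> endos n"
  by (auto simp: translation_def)

lemma translation_SA: "translation n v \<in> carrier (SA n)"
proof (rule SA_I[OF GA_I])
  show "translation n v \<in> endos n" "translation n (- v) \<in> endos n"
    by (rule translation_endos)+
  have "jacobian n (translation n v) = 1\<^sub>m n"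
    by (rule eq_matI) (auto simp: jacobian_def translation_def)
  then show "det (jacobian n (translation n v)) = 1" by simp
qed (auto simp: translation_def Const_uminus)

lemma translation_add:
  "translation n v \<otimes>\<^bsub>SA n\<^esub> translation n w = translation n (\<lambda>i. v i + w i)"
  by (auto simp: translation_mult) (auto simp: translation_def Const_add algebra_simps)

lemma translation_commute:
  "translation n v \<otimes>\<^bsub>SA n\<^esub> translation n w = translation n w \<otimes>\<^bsub>SA n\<^esub> translation n v"
  by (simp add: translation_add add.commute)

lemma translation_eq_iff: "translation n v = translation n w \<longleftrightarrow> (\<forall>i<n. v i = w i)"
proof
  assume eq: "translation n v = translation n w"
  show "\<forall>i<n. v i = w i"
  proof (intro allI impI)
    fix i assume "i < n"
    then show "v i = w i" using fun_cong[OF eq, of i] by (simp add: translation_def)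
  qed
qed (auto simp: translation_def)

lemma translation_0: "translation n (\<lambda>i. 0) = \<one>\<^bsub>SA n\<^esub>"
  by (simp add: translation_def one_SA)

lemma psubst_elementary_free:
  "p \<in> supported ({..<n} - {i}) \<Longrightarrow> psubst (elementary n i P) p = p"
  using psubst_cong[of p "{..<n} - {i}" "elementary n i P" Var] by (auto simp: elementary_def)

lemma elementary_endos: "P \<in> supported ({..<n} - {i}) \<Longrightarrow> elementary n i P \<in> endos n"
  by (auto simp: elementary_def intro!: add_supported intro: supported_mono[rotated])

text \<open>Laplace expansion along column \<open>i\<close>: off the diagonal this column vanishes,
  and deleting row and column \<open>i\<close> leaves an identity matrix. Jacobian matrices of
  elementary automorphisms have this shape.\<close>

lemma det_one_row_perturbed:
  fixes A :: "'a::comm_ring_1 mat"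
  assumes A: "A \<in> carrier_mat n n" and i: "i < n" "A $$ (i, i) = 1"
    and rows: "\<And>r s. r < n \<Longrightarrow> s < n \<Longrightarrow> r \<noteq> i \<Longrightarrow> A $$ (r, s) = (if r = s then 1 else 0)"
  shows "det A = 1"
proof -
  have "mat_delete A i i = 1\<^sub>m (n - 1)"
  proof (rule eq_matI)
    fix r s assume "r < dim_row (1\<^sub>m (n - 1))" "s < dim_col (1\<^sub>m (n - 1))"
    then show "mat_delete A i i $$ (r, s) = (1\<^sub>m (n - 1) :: 'a mat) $$ (r, s)"
      using A i by (auto simp: mat_delete_def rows)
  qed (use A in \<open>auto simp: mat_delete_def\<close>)
  then have c: "cofactor A i i = 1" by (simp add: cofactor_def)
  have "det A = (\<Sum>r<n. A $$ (r, i) * cofactor A r i)"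
    by (rule laplace_expansion_column[OF A i(1)])
  also have "\<dots> = (\<Sum>r<n. if r = i then 1 else 0)"
    by (rule sum.cong) (use i c in \<open>auto simp: rows\<close>)
  finally show ?thesis using i by simp
qed

lemma elementary_SA:
  assumes "i < n" and P: "P \<in> supported ({..<n} - {i})"
  shows "elementary n i P \<in> carrier (SA n)"
proof (rule SA_I[OF GA_I])
  show "elementary n i P \<in> endos n" "elementary n i (- P) \<in> endos n"
    using P by (simp_all add: elementary_endos)
  have free: "psubst (elementary n i Q) P = P" for Q
    using P by (rule psubst_elementary_free)
  show "psubst (elementary n i (- P)) (elementary n i P j) = Var j" if "j < n" for j
    using that free by (auto simp: elementary_def)
  show "psubst (elementary n i P) (elementary n i (- P) j) = Var j" if "j < n" for j
    using that free by (auto simp: elementary_def)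
  have "partial_deriv i P = 0" using P by (rule partial_deriv_supported) simp
  then show "det (jacobian n (elementary n i P)) = 1"
    using \<open>i < n\<close> by (intro det_one_row_perturbed[of _ n i]) (auto simp: jacobian_def elementary_def)
qed

lemma elementary_mult:
  assumes "i < n"
  shows "elementary n i P \<otimes>\<^bsub>SA n\<^esub> \<phi> = (\<lambda>j\<in>{..<n}. if j = i then \<phi> i + psubst \<phi> P else \<phi> j)"
  using assms by (auto simp: mult_SA elementary_def)

lemma elementary_add:
  assumes "i < n" "P \<in> supported ({..<n} - {i})"
  shows "elementary n i P \<otimes>\<^bsub>SA n\<^esub> elementary n i Q = elementary n i (P + Q)"
  unfolding elementary_mult[OF assms(1)] psubst_elementary_free[OF assms(2)]
  by (auto simp: elementary_def algebra_simps)

lemma elementary_0: "i < n \<Longrightarrow> elementary n i 0 = \<one>\<^bsub>SA n\<^esub>"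
  by (auto simp: elementary_def one_SA)

text \<open>The conditions on \<open>\<phi>\<close> are the shape forced by commuting with
  translations along axis \<open>i\<close>: \<open>x_i\<close> goes to \<open>x_i\<close> plus a
  polynomial free of \<open>x_i\<close>, and the other coordinates do not involve
  \<open>x_i\<close>. Such a \<open>\<phi>\<close> moves past an elementary map by mere substitution
  into \<open>P\<close>.\<close>

lemma elementary_mult_endo:
  assumes "i < n" "P \<in> supported ({..<n} - {i})" "\<phi> \<in> endos n"
    and \<phi>: "\<And>j. j < n \<Longrightarrow> j \<noteq> i \<Longrightarrow> \<phi> j \<in> supported (- {i})" "\<phi> i - Var i \<in> supported (- {i})"
  shows "psubst \<phi> P \<in> supported ({..<n} - {i})"
    and "elementary n i P \<otimes>\<^bsub>SA n\<^esub> \<phi> = \<phi> \<otimes>\<^bsub>SA n\<^esub> elementary n i (psubst \<phi> P)"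
proof -
  have \<phi>': "\<phi> j \<in> supported ({..<n} - {i})" if "j < n" "j \<noteq> i" for j
    using supported_Int[OF endos_apply[OF assms(3) that(1)] \<phi>(1)[OF that]]
    by (simp add: Diff_eq)
  show Q: "psubst \<phi> P \<in> supported ({..<n} - {i})"
    by (rule psubst_supported[OF assms(2)]) (auto intro: \<phi>')
  have "\<phi> i - Var i \<in> supported ({..<n} - {i})"
    using supported_Int[OF diff_supported[OF endos_apply[OF assms(3,1)] _] \<phi>(2)] \<open>i < n\<close>
    by (simp add: Diff_eq)
  then have "psubst (elementary n i (psubst \<phi> P)) (Var i + (\<phi> i - Var i)) = \<phi> i + psubst \<phi> P"
    using \<open>i < n\<close> by (simp only: psubst_add psubst_elementary_free) (simp add: elementary_def)
  then show "elementary n i P \<otimes>\<^bsub>SA n\<^esub> \<phi> = \<phi> \<otimes>\<^bsub>SA n\<^esub> elementary n i (psubst \<phi> P)"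
    by (subst elementary_mult[OF \<open>i < n\<close>], unfold mult_SA, intro restrict_ext)
      (auto simp: \<phi>' psubst_elementary_free)
qed

section \<open>Normal subgroups: from one elementary automorphism to all transvections\<close>

context
  fixes n :: nat and N :: "(nat \<Rightarrow> 'k::field_char_0 mpoly) set"
  assumes normal: "N \<lhd> SA n"
begin

interpretation N: normal N "SA n" by (rule normal)

lemma conj_mem:
  assumes "x \<in> N" "g \<in> carrier (SA n)" "y \<in> carrier (SA n)" "x \<otimes>\<^bsub>SA n\<^esub> g = g \<otimes>\<^bsub>SA n\<^esub> y"
  shows "y \<in> N"
proof -
  have "y = inv\<^bsub>SA n\<^esub> g \<otimes>\<^bsub>SA n\<^esub> x \<otimes>\<^bsub>SA n\<^esub> g"
    using assms N.mem_carrier by (simp add: N.m_assoc N.inv_solve_left)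
  then show ?thesis using assms by (simp add: N.inv_op_closed1)
qed

lemma left_quotient_mem:
  assumes "x \<in> N" "z \<in> N" "y \<in> carrier (SA n)" "x \<otimes>\<^bsub>SA n\<^esub> y = z"
  shows "y \<in> N"
proof -
  have "y = inv\<^bsub>SA n\<^esub> x \<otimes>\<^bsub>SA n\<^esub> z"
    using assms N.mem_carrier by (auto simp: N.inv_solve_left)
  then show ?thesis using assms by simp
qed

text \<open>The commutator of the elementary map with \<open>\<phi>\<close> is again elementary,
  because conjugation by \<open>\<phi>\<close> only substitutes into \<open>P\<close>. Here it is in
  \<open>N\<close> on account of the elementary map, and \<open>\<phi>\<close> may be
  chosen.\<close>

lemma elementary_diff_mem_of_elementary:
  assumes "i < n" "P \<in> supported ({..<n} - {i})" "elementary n i P \<in> N" "\<phi> \<in> carrier (SA n)"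
    and "\<And>j. j < n \<Longrightarrow> j \<noteq> i \<Longrightarrow> \<phi> j \<in> supported (- {i})" "\<phi> i - Var i \<in> supported (- {i})"
  shows "elementary n i (psubst \<phi> P - P) \<in> N"
proof -
  note * = elementary_mult_endo[OF assms(1,2) SA_endos[OF assms(4)] assms(5,6)]
  have "elementary n i (psubst \<phi> P) \<in> N"
    using conj_mem[OF assms(3,4) elementary_SA[OF assms(1) *(1)] *(2)] .
  moreover have "elementary n i (psubst \<phi> P - P) \<in> carrier (SA n)"
    using *(1) assms(1,2) by (intro elementary_SA diff_supported)
  moreover have "elementary n i P \<otimes>\<^bsub>SA n\<^esub> elementary n i (psubst \<phi> P - P) = elementary n i (psubst \<phi> P)"
    by (simp add: elementary_add[OF assms(1,2)])
  ultimately show ?thesis by (rule left_quotient_mem[OF assms(3)])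
qed

text \<open>The same commutator with the roles exchanged: it is in \<open>N\<close> on account of
  \<open>\<phi>\<close>, and \<open>P\<close> may be chosen.\<close>

lemma elementary_diff_mem:
  assumes "i < n" "P \<in> supported ({..<n} - {i})" "\<phi> \<in> N"
    and "\<And>j. j < n \<Longrightarrow> j \<noteq> i \<Longrightarrow> \<phi> j \<in> supported (- {i})" "\<phi> i - Var i \<in> supported (- {i})"
  shows "elementary n i (psubst \<phi> P - P) \<in> N"
proof -
  have \<phi>: "\<phi> \<in> carrier (SA n)" using assms(3) by simp
  note * = elementary_mult_endo[OF assms(1,2) SA_endos[OF \<phi>] assms(4,5)]
  let ?e = "elementary n i P" and ?d = "elementary n i (psubst \<phi> P - P)"
  have e: "?e \<in> carrier (SA n)" "?d \<in> carrier (SA n)"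
    using assms(1,2) *(1) by (simp_all add: elementary_SA)
  have "?d \<otimes>\<^bsub>SA n\<^esub> ?e = elementary n i (psubst \<phi> P)"
    using assms(2) *(1) by (subst elementary_add[OF assms(1)]) simp_all
  then have "\<phi> \<otimes>\<^bsub>SA n\<^esub> ?d \<otimes>\<^bsub>SA n\<^esub> ?e = ?e \<otimes>\<^bsub>SA n\<^esub> \<phi>"
    using *(2) e \<phi> by (simp add: N.m_assoc)
  then have "\<phi> \<otimes>\<^bsub>SA n\<^esub> ?d = ?e \<otimes>\<^bsub>SA n\<^esub> \<phi> \<otimes>\<^bsub>SA n\<^esub> inv\<^bsub>SA n\<^esub> ?e"
    by (metis N.inv_solve_right' N.m_closed e \<phi>)
  then show ?thesis
    using left_quotient_mem[OF assms(3) _ e(2)] N.inv_op_closed2[OF e(1) assms(3)] by simp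
qed

text \<open>Induction on a degree bound: a unit translation that changes \<open>P\<close> replaces
  it by a nonzero difference of smaller degree. If no unit translation changes \<open>P\<close>,
  then \<open>P\<close> is free of every variable and hence constant.\<close>

lemma elementary_Const_mem_of_elementary:
  assumes "i < n" "P \<in> supported ({..<n} - {i})" "elementary n i P \<in> N" "P \<noteq> 0"
  shows "\<exists>c. c \<noteq> 0 \<and> elementary n i (Const c) \<in> N"
proof -
  obtain d where "P \<in> degree_below d" using degree_below_exists by blast
  then show ?thesis using assms(2-)
  proof (induction d arbitrary: P)
    case 0
    then show ?case by (simp add: degree_below_0)
  next
    case (Suc d)
    show ?case
    proof (cases "\<exists>j v. shift (\<lambda>l. if l = j then (1::'k) else 0) P \<noteq> P")
      case True
      then obtain j where j: "shift (\<lambda>l. if l = j then 1 else 0) P \<noteq> P" by blast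
      let ?t = "translation n (\<lambda>l. if l = j then 1 else 0 :: 'k)"
      have "P \<in> supported {..<n}" using Suc.prems(2) by (rule supported_mono[rotated]) auto
      then have eq: "psubst ?t P = shift (\<lambda>l. if l = j then 1 else 0) P"
        by (rule psubst_translation)
      have t: "?t l \<in> supported (- {i})" if "l < n" "l \<noteq> i" for l
        using that by (auto simp: translation_def)
      have ti: "?t i - Var i \<in> supported (- {i})"
        using \<open>i < n\<close> by (auto simp: translation_def)
      have "elementary n i (psubst ?t P - P) \<in> N"
        by (rule elementary_diff_mem_of_elementary[OF \<open>i < n\<close> Suc.prems(2,3) translation_SA t ti])
      moreover have "psubst ?t P - P \<in> degree_below d"
        using Suc.prems(1) by (simp only: eq shift_diff_degree)
      moreover have "psubst ?t P - P \<in> supported ({..<n} - {i})"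
        using elementary_mult_endo(1)[OF \<open>i < n\<close> Suc.prems(2) translation_endos t ti] Suc.prems(2)
        by simp
      ultimately show ?thesis using Suc.IH j eq by simp
    next
      case False
      have "P \<in> supported (- {j})" for j
        using False by (intro shift_invariant_supported[of j 1]) auto
      then have "P \<in> supported {}" unfolding supported_def by blast
      then obtain c where "P = Const c" using supported_empty by blast
      then show ?thesis using Suc.prems by auto
    qed
  qed
qed

lemma elementary_Const_mem_other:
  assumes "i < n" "k < n" "k \<noteq> i" "c \<noteq> 0" "elementary n i (Const c) \<in> N"
  shows "elementary n k (Const a) \<in> N"
proof -
  \<comment> \<open>The translation by \<open>c\<close> along axis \<open>i\<close> changes this
    linear polynomial by exactly \<open>a\<close>.\<close>
  let ?P = "Const (a / c) * Var i :: 'k mpoly"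
  have "elementary n k (psubst (elementary n i (Const c)) ?P - ?P) \<in> N"
    by (rule elementary_diff_mem[OF assms(2) _ assms(5)])
      (use assms in \<open>auto simp: elementary_def\<close>)
  moreover have "psubst (elementary n i (Const c)) ?P - ?P = Const (a / c * c)"
    using assms by (simp add: elementary_def algebra_simps flip: Const_mult)
  ultimately show ?thesis using \<open>c \<noteq> 0\<close> by simp
qed

lemma transvection_mem:
  assumes "n \<ge> 2" "i < n" "c \<noteq> 0" "elementary n i (Const c) \<in> N" "k < n" "l < n" "k \<noteq> l"
  shows "elementary n k (Const a * Var l) \<in> N"
proof -
  \<comment> \<open>The previous lemma only reaches axes different from \<open>i\<close>. Arbitrary
    constants on axis \<open>i\<close> itself are obtained by a detour through a second axis
    \<open>j\<close>, which exists because \<open>n \<ge> 2\<close>.\<close>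
  obtain j where j: "j < n" "j \<noteq> i"
    using \<open>n \<ge> 2\<close> by (metis One_nat_def Suc_lessD less_le_trans lessI numeral_2_eq_2 zero_neq_one)
  have t: "elementary n r (Const b) \<in> N" if "r < n" for r b
  proof (cases "r = i")
    case True
    then show ?thesis
      using elementary_Const_mem_other[OF j(1) that, of 1 b]
        elementary_Const_mem_other[OF assms(2) j assms(3,4), of 1] j by simp
  qed (use elementary_Const_mem_other[OF assms(2) that _ assms(3,4)] in simp)
  \<comment> \<open>The difference of \<open>(a/2) x_l^2\<close> under
    \<open>x_l \<mapsto> x_l + 1\<close> is \<open>a x_l + a/2\<close>; the constant part is a
    translation already known to be in \<open>N\<close> and is divided off.\<close>
  let ?P = "Const (a / 2) * Var l * Var l :: 'k mpoly" and ?t = "elementary n l (Const 1 :: 'k mpoly)"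
  have free: "Const a * Var l \<in> supported ({..<n} - {k})" "Const (a / 2) \<in> supported ({..<n} - {k})"
    using assms by auto
  have "elementary n k (psubst ?t ?P - ?P) \<in> N"
    by (rule elementary_diff_mem[OF \<open>k < n\<close> _ t[OF \<open>l < n\<close>]])
      (use assms in \<open>auto simp: elementary_def\<close>)
  moreover have "psubst ?t ?P - ?P = Const (a / 2) + Const a * Var l"
  proof -
    have "psubst ?t (Var l) = Var l + 1"
      using assms by (simp add: elementary_def)
    moreover have "(Const a :: 'k mpoly) = Const (a / 2) + Const (a / 2)"
      by (simp flip: Const_add)
    moreover have "h * (x + 1) * (x + 1) - h * x * x = h + (h + h) * x" for h x :: "'k mpoly"
      by (simp add: algebra_simps)
    ultimately show ?thesis by (simp only: psubst_mult psubst_Const)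
  qed
  ultimately have "elementary n k (Const (a / 2) + Const a * Var l) \<in> N" by (simp only:)
  moreover have "elementary n k (Const (a / 2)) \<otimes>\<^bsub>SA n\<^esub> elementary n k (Const a * Var l) =
      elementary n k (Const (a / 2) + Const a * Var l)"
    using \<open>k < n\<close> free(2) by (rule elementary_add)
  ultimately show ?thesis
    using left_quotient_mem[OF t[OF \<open>k < n\<close>] _ elementary_SA[OF \<open>k < n\<close> free(1)]] by blast
qed

end


section \<open>Normal subgroups containing the special linear group\<close>

text \<open>Gaussian elimination with row additions only. The rule passes \<open>Q\<close> back from
  the reduced matrix to \<open>A\<close>, so elimination ends at the identity matrix. Rows are never
  rescaled: pivots are made 1 by row additions, and the last one is 1 by the determinant.\<close>

lemma det_1_row_induct [consumes 2, case_names one addrow]: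
  fixes A :: "'a::field mat"
  assumes A: "A \<in> carrier_mat n n" "det A = 1"
    and one: "Q (1\<^sub>m n)"
    and addrow: "\<And>A a k l. A \<in> carrier_mat n n \<Longrightarrow> k < n \<Longrightarrow> l < n \<Longrightarrow> k \<noteq> l \<Longrightarrow>
      Q (addrow a k l A) \<Longrightarrow> Q A"
  shows "Q A"
proof -
  define U where "U = (\<lambda>m A. A \<in> carrier_mat n n \<and> det A = (1::'a) \<and>
    (\<forall>i<n. \<forall>j<m. A $$ (i, j) = (if i = j then 1 else 0)))"
  \<comment> \<open>The added row \<open>l\<close> has index at least \<open>m\<close>, so it
    vanishes in the finished columns and leaves them intact.\<close>
  have U_addrow: "U m (addrow a k l A)"
    if "U m A" "k < n" "l < n" "k \<noteq> l" "m \<le> l" "m \<le> n" for m A a k l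
    using that det_addrow[of l n k A a] by (auto simp: U_def)
  have "Q A" if "U m A" "m \<le> n" for m A
    using that
  proof (induction "n - m" arbitrary: m A)
    case 0
    then have "A = 1\<^sub>m n" by (intro eq_matI) (auto simp: U_def)
    then show ?case using one by simp
  next
    case (Suc d)
    then have m: "m < n" by simp
    \<comment> \<open>Once the pivot is 1, its row clears the other entries of column
      \<open>m\<close> one by one; their number is the induction measure.\<close>
    have pivot_1: "Q A" if "U m A" "A $$ (m, m) = 1" for A
      using that
    proof (induction "card {i. i < n \<and> i \<noteq> m \<and> A $$ (i, m) \<noteq> 0}" arbitrary: A rule: less_induct)
      case less
      show ?case
      proof (cases "\<exists>i<n. i \<noteq> m \<and> A $$ (i, m) \<noteq> 0")
        case True
        then obtain i where i: "i < n" "i \<noteq> m" "A $$ (i, m) \<noteq> 0" by blast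
        let ?B = "addrow (- A $$ (i, m)) i m A"
        have dim: "dim_row A = n" "dim_col A = n" using less.prems by (auto simp: U_def)
        have "{r. r < n \<and> r \<noteq> m \<and> ?B $$ (r, m) \<noteq> 0} =
          {r. r < n \<and> r \<noteq> m \<and> A $$ (r, m) \<noteq> 0} - {i}"
          using m i less.prems(2) by (auto simp: dim split: if_splits)
        then have "card {r. r < n \<and> r \<noteq> m \<and> ?B $$ (r, m) \<noteq> 0} <
          card {r. r < n \<and> r \<noteq> m \<and> A $$ (r, m) \<noteq> 0}"
          using i by (simp only:) (rule card_Diff1_less, auto)
        moreover have "U m ?B" using less.prems i m by (intro U_addrow) auto
        moreover have "?B $$ (m, m) = 1" using less.prems m i by (simp add: dim)
        ultimately have "Q ?B" by (intro less.hyps)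
        then show ?thesis
          using addrow[of A i m "- A $$ (i, m)"] i m less.prems by (auto simp: U_def)
      next
        case False
        have "U (Suc m) A"
          using less.prems False m by (auto simp: U_def less_Suc_eq)
        then show ?thesis using Suc.hyps m by (intro Suc.hyps(1)[of "Suc m"]) auto
      qed
    qed
    have below_pivot: "Q A" if "U m A" "m < i" "i < n" "A $$ (i, m) \<noteq> 0" for A i
    proof -
      \<comment> \<open>The factor that makes the new pivot \<open>A_mm + a A_im\<close> equal to
        1.\<close>
      let ?a = "(1 - A $$ (m, m)) / A $$ (i, m)"
      have dim: "A \<in> carrier_mat n n" "dim_row A = n" "dim_col A = n" using that by (auto simp: U_def)
      have "U m (addrow ?a m i A)" using that by (intro U_addrow) auto
      moreover have "addrow ?a m i A $$ (m, m) = 1" using that m by (simp add: dim)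
      ultimately have "Q (addrow ?a m i A)" by (rule pivot_1)
      then show ?thesis using addrow[of A m i ?a] dim(1) m that by simp
    qed
    have dim: "A \<in> carrier_mat n n" "dim_row A = n" "dim_col A = n" using Suc.prems by (auto simp: U_def)
    show ?case
    proof (cases "\<exists>i<n. m < i \<and> A $$ (i, m) \<noteq> 0")
      case True
      then show ?thesis using below_pivot Suc.prems(1) by blast
    next
      case False
      have unit: "A $$ (i, j) = (if i = j then 1 else 0)" if "i < n" "j < m" for i j
        using Suc.prems that by (auto simp: U_def)
      have pivot: "A $$ (m, m) \<noteq> 0"
      proof
        assume 0: "A $$ (m, m) = 0"
        \<comment> \<open>With zeros from row \<open>m\<close> on, column \<open>m\<close> is a
          combination of the unit columns before it. This relation is a nonzero kernel vector,
          contradicting determinant 1.\<close>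
        define v where "v = vec n (\<lambda>j. if j = m then 1 else if j < m then - A $$ (j, m) else 0)"
        have v: "v \<in> carrier_vec n" "v $ m = 1" using m by (auto simp: v_def)
        have "A *\<^sub>v v = 0\<^sub>v n"
        proof (rule eq_vecI)
          fix i assume "i < dim_vec (0\<^sub>v n)"
          then have i: "i < n" by simp
          have "(A *\<^sub>v v) $ i = (\<Sum>j\<in>{0..<n}. A $$ (i, j) * v $ j)"
            using i dim v by (simp add: scalar_prod_def)
          also have "\<dots> = (\<Sum>j\<in>{0..<n}. (if j = m then A $$ (i, m) else 0) +
              (if j = i then if i < m then - A $$ (i, m) else 0 else 0))"
            by (rule sum.cong) (auto simp: v_def unit i)
          also have "\<dots> = A $$ (i, m) + (if i < m then - A $$ (i, m) else 0)"
            using m i by (simp add: sum.distrib)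
          also have "\<dots> = 0"
            using False 0 i by (cases i m rule: linorder_cases) auto
          finally show "(A *\<^sub>v v) $ i = 0\<^sub>v n $ i" using i by simp
        qed (use dim in auto)
        moreover have "v \<noteq> 0\<^sub>v n" using v m by auto
        ultimately have "det A = 0" using v det_0_iff_vec_prod_zero[OF dim(1)] by blast
        then show False using Suc.prems by (auto simp: U_def)
      qed
      show ?thesis
      proof (cases "Suc m < n")
        case True
        \<comment> \<open>Nothing nonzero lies below the pivot, so the pivot row is added to the
          next row to create such an entry.\<close>
        let ?B = "addrow 1 (Suc m) m A"
        have "U m ?B" using Suc.prems True by (intro U_addrow) auto
        moreover have "?B $$ (Suc m, m) \<noteq> 0"
          using True False pivot by (simp add: dim)
        ultimately have "Q ?B" using True by (intro below_pivot[of ?B "Suc m"]) auto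
        then show ?thesis using addrow[of A "Suc m" m 1] dim(1) True by simp
      next
        case last: False
        then have n: "n = Suc m" using m by simp
        \<comment> \<open>In the last column there is no row below to help, but all earlier diagonal
          entries are 1, so the determinant is the last pivot.\<close>
        have "upper_triangular A"
          using unit by (auto simp: upper_triangular_def dim n)
        then have "det A = (\<Prod>i\<in>{0..<n}. A $$ (i, i))"
          using dim by (simp add: det_upper_triangular[OF _ dim(1)] prod_list_diag_prod)
        also have "\<dots> = A $$ (m, m)" using unit by (simp add: n)
        finally have "A $$ (m, m) = 1" using Suc.prems by (simp add: U_def)
        then show ?thesis using pivot_1 Suc.prems by blast
      qed
    qed
  qed
  from this[of 0 A] show ?thesis using A by (simp add: U_def)
qed

lemma linear_endo_endos: "linear_endo n A \<in> endos n"
  by (auto simp: linear_endo_def intro!: sum_supported mult_supported)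

lemma linear_endo_1: "(linear_endo n (1\<^sub>m n) :: nat \<Rightarrow> 'k::comm_ring_1 mpoly) = \<one>\<^bsub>SA n\<^esub>"
proof (rule endo_eqI)
  fix i assume "i < n"
  have "(\<Sum>j<n. Const (1\<^sub>m n $$ (i, j)) * Var j) = (\<Sum>j<n. if j = i then Var i else (0::'k mpoly))"
    using \<open>i < n\<close> by (intro sum.cong) auto
  then show "(linear_endo n (1\<^sub>m n) :: nat \<Rightarrow> 'k mpoly) i = \<one>\<^bsub>SA n\<^esub> i"
    using \<open>i < n\<close> by (simp add: linear_endo_def one_SA)
qed (auto simp: linear_endo_def one_SA)

text \<open>Left multiplication by a transvection acts on the coordinates as a row addition, here
  with \<open>- a\<close> to undo \<open>addrow\<close>. This turns the matrix induction into
  membership in \<open>N\<close>.\<close>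

lemma elementary_mult_linear_endo:
  assumes "A \<in> carrier_mat n n" "k < n" "l < n" "k \<noteq> l"
  shows "elementary n k (Const (- a) * Var l) \<otimes>\<^bsub>SA n\<^esub> linear_endo n (addrow a k l A) = linear_endo n A"
proof -
  have dim: "dim_row A = n" "dim_col A = n" using assms(1) by auto
  have "linear_endo n (addrow a k l A) i =
    (if i = k then linear_endo n A k + Const a * linear_endo n A l else linear_endo n A i)" if "i < n" for i
    using that assms dim
    by (auto simp: linear_endo_def Const_add Const_mult algebra_simps sum.distrib sum_distrib_left intro!: sum.cong)
  then show ?thesis
    unfolding elementary_mult[OF assms(2)]
    using assms linear_endo_endos[of n A]
    by (intro endo_eqI[of _ n]) (auto simp: Const_uminus PiE_def)
qed

section \<open>Normal subgroups with an element commuting with a translation\<close>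

context
  fixes n :: nat and N :: "(nat \<Rightarrow> 'k::field_char_0 mpoly) set"
  assumes normal: "N \<lhd> SA n" and n: "n \<ge> 2"
begin

interpretation N: normal N "SA n" by (rule normal)

lemma SL_subset:
  assumes "i < n" "P \<in> supported ({..<n} - {i})" "elementary n i P \<in> N" "P \<noteq> 0"
  shows "SL n \<subseteq> N"
proof -
  obtain c where c: "c \<noteq> 0" "elementary n i (Const c) \<in> N"
    using elementary_Const_mem_of_elementary[OF normal assms] by blast
  have "linear_endo n A \<in> N" if "A \<in> carrier_mat n n" "det A = 1" for A
    using that
  proof (induction rule: det_1_row_induct)
    case one
    show ?case by (simp add: linear_endo_1)
  next
    case (addrow A a k l)
    have "elementary n k (Const (- a) * Var l) \<in> N"
      using addrow by (intro transvection_mem[OF normal n assms(1) c])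
    then show ?case
      using N.subgroup_axioms[THEN subgroup.m_closed] addrow elementary_mult_linear_endo[of A n k l a]
      by metis
  qed
  then show ?thesis by (auto simp: SL_def)
qed

lemma SL_subset_of_commuting_axis_translation:
  assumes X: "X \<in> N" "X \<noteq> \<one>\<^bsub>SA n\<^esub>" and "i < n" "c \<noteq> 0"
    and comm: "X \<otimes>\<^bsub>SA n\<^esub> translation n (\<lambda>j. if j = i then c else 0) =
      translation n (\<lambda>j. if j = i then c else 0) \<otimes>\<^bsub>SA n\<^esub> X"
  shows "SL n \<subseteq> N"
proof -
  let ?v = "\<lambda>j. if j = i then c else 0"
  have XE: "X \<in> endos n" using X(1) N.subset SA_endos by blast
  have "shift ?v (X j) = X j + Const (?v j)" if "j < n" for j
    using fun_cong[OF comm, of j] that by (simp add: mult_translation[OF XE] translation_mult)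
  moreover have "shift ?v (Var i) = Var i + Const c" by (simp add: shift_def)
  \<comment> \<open>Commuting with the translation says that shifting \<open>x_i\<close> by
    \<open>c\<close> adds \<open>c\<close> to coordinate \<open>i\<close> and nothing to the others.
    Subtracting \<open>Var i\<close> makes all these polynomials shift-invariant, hence free of
    \<open>x_i\<close>.\<close>
  ultimately have "shift ?v (X i - Var i) = X i - Var i" "\<And>j. j < n \<Longrightarrow> j \<noteq> i \<Longrightarrow> shift ?v (X j) = X j"
    using \<open>i < n\<close> by (simp_all add: shift_def)
  then have free: "\<And>j. j < n \<Longrightarrow> j \<noteq> i \<Longrightarrow> X j \<in> supported (- {i})" "X i - Var i \<in> supported (- {i})"
    using shift_invariant_supported \<open>c \<noteq> 0\<close> by blast+
  show ?thesis
  proof (cases "\<exists>j<n. j \<noteq> i \<and> X j \<noteq> Var j")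
    case True
    then obtain j where j: "j < n" "j \<noteq> i" "X j \<noteq> Var j" by blast
    \<comment> \<open>\<open>P = x_j\<close> turns the displacement of coordinate \<open>j\<close>
      into a nonzero elementary map on coordinate \<open>i\<close>. If no such \<open>j\<close>
      exists, \<open>X\<close> is itself elementary.\<close>
    have "elementary n i (psubst X (Var j) - Var j) \<in> N"
      using j by (intro elementary_diff_mem[OF normal \<open>i < n\<close> _ X(1) free]) auto
    moreover have "psubst X (Var j) - Var j \<in> supported ({..<n} - {i})"
      using j elementary_mult_endo(1)[OF \<open>i < n\<close> _ XE free, of "Var j"] by simp
    ultimately show ?thesis
      using j by (intro SL_subset[OF \<open>i < n\<close>]) auto
  next
    case False
    have "X i - Var i \<in> supported ({..<n} - {i})"
      using supported_Int[OF diff_supported[OF endos_apply[OF XE \<open>i < n\<close>] _] free(2)] \<open>i < n\<close>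
      by (simp add: Diff_eq)
    moreover have X_eq: "X = elementary n i (X i - Var i)"
      using False XE by (intro endo_eqI[of _ n]) (auto simp: elementary_def PiE_def)
    moreover have "X i - Var i \<noteq> 0"
      using X(2) X_eq elementary_0[OF \<open>i < n\<close>] by metis
    ultimately show ?thesis
      using X(1) by (intro SL_subset[OF \<open>i < n\<close>, of "X i - Var i"]) auto
  qed
qed

text \<open>Conjugation by shears straightens the translation vector: each one kills a further
  coordinate \<open>j \<noteq> i\<close> while the conjugate of \<open>X\<close> stays in
  \<open>N\<close>, nontrivial and commuting. The axis case remains.\<close>

lemma SL_subset_of_commuting_translation:
  assumes "X \<in> N" "X \<noteq> \<one>\<^bsub>SA n\<^esub>" "i < n" "v i \<noteq> 0"
    and "X \<otimes>\<^bsub>SA n\<^esub> translation n v = translation n v \<otimes>\<^bsub>SA n\<^esub> X"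
  shows "SL n \<subseteq> N"
  using assms(1,2,4,5)
proof (induction "card {j. j < n \<and> j \<noteq> i \<and> v j \<noteq> 0}" arbitrary: X v rule: less_induct)
  case less
  show ?case
  proof (cases "\<exists>j<n. j \<noteq> i \<and> v j \<noteq> 0")
    case False
    then have "translation n v = translation n (\<lambda>j. if j = i then v i else 0)"
      by (auto simp: translation_eq_iff)
    then show ?thesis
      using less.prems \<open>i < n\<close> SL_subset_of_commuting_axis_translation[of X i "v i"] by simp
  next
    case True
    then obtain j where j: "j < n" "j \<noteq> i" "v j \<noteq> 0" by blast
    define w where "w = v(j := 0)"
    \<comment> \<open>The shear subtracts \<open>v j / v i\<close> times coordinate \<open>i\<close>
      from coordinate \<open>j\<close>, and so maps the vector \<open>v\<close> to
      \<open>w\<close>.\<close>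
    define g where "g = elementary n j (Const (- v j / v i) * Var i)"
    let ?t = "translation n v" and ?t' = "translation n w"
    have g: "g \<in> carrier (SA n)"
      unfolding g_def using j \<open>i < n\<close> by (intro elementary_SA) auto
    have X: "X \<in> carrier (SA n)" using less.prems by simp
    have gt: "g \<otimes>\<^bsub>SA n\<^esub> ?t = ?t' \<otimes>\<^bsub>SA n\<^esub> g"
      using j \<open>i < n\<close> less.prems(3)
      unfolding g_def elementary_mult[OF j(1)] translation_mult
      by (auto simp: translation_def elementary_def w_def algebra_simps simp flip: Const_mult Const_add)
    let ?X = "g \<otimes>\<^bsub>SA n\<^esub> X \<otimes>\<^bsub>SA n\<^esub> inv\<^bsub>SA n\<^esub> g"
    note t = translation_SA[of n v] translation_SA[of n w]
    have t': "?t' = g \<otimes>\<^bsub>SA n\<^esub> ?t \<otimes>\<^bsub>SA n\<^esub> inv\<^bsub>SA n\<^esub> g"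
      using gt g t by (simp add: N.m_assoc)
    have cancel: "inv\<^bsub>SA n\<^esub> g \<otimes>\<^bsub>SA n\<^esub> (g \<otimes>\<^bsub>SA n\<^esub> z) = z" if "z \<in> carrier (SA n)" for z
      using that g by (simp flip: N.m_assoc)
    have "X \<otimes>\<^bsub>SA n\<^esub> (?t \<otimes>\<^bsub>SA n\<^esub> z) = ?t \<otimes>\<^bsub>SA n\<^esub> (X \<otimes>\<^bsub>SA n\<^esub> z)" if "z \<in> carrier (SA n)" for z
      using that X t less.prems(4) by (metis N.m_assoc)
    then have "?X \<otimes>\<^bsub>SA n\<^esub> ?t' = ?t' \<otimes>\<^bsub>SA n\<^esub> ?X"
      unfolding t' using X g t cancel by (simp add: N.m_assoc)
    moreover have "?X \<noteq> \<one>\<^bsub>SA n\<^esub>"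
    proof
      assume "?X = \<one>\<^bsub>SA n\<^esub>"
      then have "inv\<^bsub>SA n\<^esub> g \<otimes>\<^bsub>SA n\<^esub> ?X \<otimes>\<^bsub>SA n\<^esub> g = \<one>\<^bsub>SA n\<^esub>" using g by simp
      then show False using less.prems(2) X g cancel by (simp add: N.m_assoc)
    qed
    moreover have "?X \<in> N" using g less.prems(1) by (rule N.inv_op_closed2)
    moreover have "card {r. r < n \<and> r \<noteq> i \<and> w r \<noteq> 0} < card {r. r < n \<and> r \<noteq> i \<and> v r \<noteq> 0}"
      using j by (intro psubset_card_mono) (auto simp: w_def)
    moreover have "w i \<noteq> 0" using j less.prems(3) by (simp add: w_def)
    ultimately show ?thesis using less.hyps by blast
  qed
qed

end


section \<open>Affine and triangular automorphisms\<close>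

definition affine_endo :: "nat \<Rightarrow> 'k::comm_ring_1 mat \<Rightarrow> (nat \<Rightarrow> 'k) \<Rightarrow> nat \<Rightarrow> 'k mpoly"
  where "affine_endo n A b = (\<lambda>i\<in>{..<n}. (\<Sum>j<n. Const (A $$ (i, j)) * Var j) + Const (b i))"

definition affine_SA :: "nat \<Rightarrow> (nat \<Rightarrow> 'k::field mpoly) set"
  where "affine_SA n = {\<phi> \<in> carrier (SA n). \<exists>A b. A \<in> carrier_mat n n \<and> det A \<noteq> 0 \<and> \<phi> = affine_endo n A b}"

definition triangular_SA :: "nat \<Rightarrow> (nat \<Rightarrow> 'k::field mpoly) set"
  where "triangular_SA n = {\<phi> \<in> carrier (SA n). \<exists>a P. \<forall>i<n.
    a i \<noteq> 0 \<and> P i \<in> supported {..<i} \<and> \<phi> i = Const (a i) * Var i + P i}"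

text \<open>With indexing from 0, \<open>n - 1\<close> is the last variable, the one that occurs in
  none of the polynomials \<open>P i\<close> of a triangular automorphism. This makes the set stable
  under triangular conjugation.\<close>

definition last_translations :: "nat \<Rightarrow> (nat \<Rightarrow> 'k::comm_ring_1 mpoly) set"
  where "last_translations n = range (\<lambda>c. translation n (\<lambda>i. if i = n - 1 then c else 0))"

lemma affine_endo_mult_translation:
  "affine_endo n A b \<otimes>\<^bsub>SA n\<^esub> translation n v =
    translation n (\<lambda>i. \<Sum>j<n. A $$ (i, j) * v j) \<otimes>\<^bsub>SA n\<^esub> affine_endo n A b"
  unfolding translation_mult mult_SA
  by (intro restrict_ext)
    (auto simp: affine_endo_def translation_def Const_sum Const_mult algebra_simps sum.distrib)

lemma triangular_mult_translation:
  assumes "\<phi> \<in> endos n" "n > 0"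
    and \<phi>: "\<And>i. i < n \<Longrightarrow> P i \<in> supported {..<i} \<and> \<phi> i = Const (a i) * Var i + P i"
  shows "\<phi> \<otimes>\<^bsub>SA n\<^esub> translation n (\<lambda>i. if i = n - 1 then c else 0) =
    translation n (\<lambda>i. if i = n - 1 then a (n - 1) * c else 0) \<otimes>\<^bsub>SA n\<^esub> \<phi>"
  unfolding translation_mult mult_translation[OF assms(1)]
proof (intro restrict_ext)
  fix i assume "i \<in> {..<n}"
  then have i: "i < n" by simp
  have "shift (\<lambda>i. if i = n - 1 then c else 0) (P i) = psubst Var (P i)"
    unfolding shift_def using \<phi>[OF i] i by (intro psubst_cong[of _ "{..<i}"]) auto
  then show "shift (\<lambda>i. if i = n - 1 then c else 0) (\<phi> i) =
      \<phi> i + Const (if i = n - 1 then a (n - 1) * c else 0)"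
    using \<phi>[OF i] by (auto simp: shift_def Const_mult algebra_simps)
qed

section \<open>Conjugating translations by affine and triangular automorphisms\<close>

context
  fixes n :: nat
  assumes n: "n > 0" and group_SA: "group (SA n :: (nat \<Rightarrow> 'k::field mpoly) monoid)"
begin

interpretation SA: group "SA n :: (nat \<Rightarrow> 'k::field mpoly) monoid" by (rule group_SA)

lemma conj_eqI:
  fixes x s t :: "nat \<Rightarrow> 'k mpoly"
  assumes "x \<in> carrier (SA n)" "s \<in> carrier (SA n)" "t \<in> carrier (SA n)" "x \<otimes>\<^bsub>SA n\<^esub> s = t \<otimes>\<^bsub>SA n\<^esub> x"
  shows "x \<otimes>\<^bsub>SA n\<^esub> s \<otimes>\<^bsub>SA n\<^esub> inv\<^bsub>SA n\<^esub> x = t" "inv\<^bsub>SA n\<^esub> x \<otimes>\<^bsub>SA n\<^esub> t \<otimes>\<^bsub>SA n\<^esub> x = s"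
proof -
  show "x \<otimes>\<^bsub>SA n\<^esub> s \<otimes>\<^bsub>SA n\<^esub> inv\<^bsub>SA n\<^esub> x = t" using assms by (simp add: SA.m_assoc)
  show "inv\<^bsub>SA n\<^esub> x \<otimes>\<^bsub>SA n\<^esub> t \<otimes>\<^bsub>SA n\<^esub> x = s"
    using assms by (simp add: SA.m_assoc flip: assms(4))
qed

lemma affine_SA_conj_translation:
  fixes \<alpha> :: "nat \<Rightarrow> 'k mpoly"
  assumes \<alpha>: "\<alpha> \<in> affine_SA n" and t: "t \<in> range (translation n)"
  shows "\<alpha> \<otimes>\<^bsub>SA n\<^esub> t \<otimes>\<^bsub>SA n\<^esub> inv\<^bsub>SA n\<^esub> \<alpha> \<in> range (translation n)"
    and "inv\<^bsub>SA n\<^esub> \<alpha> \<otimes>\<^bsub>SA n\<^esub> t \<otimes>\<^bsub>SA n\<^esub> \<alpha> \<in> range (translation n)"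
proof -
  obtain v where v: "t = translation n v" using t by blast
  obtain A b where A: "A \<in> carrier_mat n n" "det A \<noteq> 0" and eq: "\<alpha> = affine_endo n A b"
    and \<alpha>_SA: "\<alpha> \<in> carrier (SA n)"
    using \<alpha> by (auto simp: affine_SA_def)
  have comm: "\<alpha> \<otimes>\<^bsub>SA n\<^esub> translation n w = translation n (\<lambda>i. \<Sum>j<n. A $$ (i, j) * w j) \<otimes>\<^bsub>SA n\<^esub> \<alpha>" for w
    unfolding eq by (rule affine_endo_mult_translation)
  show "\<alpha> \<otimes>\<^bsub>SA n\<^esub> t \<otimes>\<^bsub>SA n\<^esub> inv\<^bsub>SA n\<^esub> \<alpha> \<in> range (translation n)"
    using conj_eqI(1)[OF \<alpha>_SA translation_SA translation_SA comm] by (simp add: v)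
  obtain B where B: "B \<in> carrier_mat n n" "A * B = 1\<^sub>m n"
    using det_non_zero_imp_unit[OF A, of "()"] by (auto simp: Units_def ring_mat_def)
  \<comment> \<open>\<open>B\<close> inverts the linear part, so \<open>w\<close> is the preimage of
    \<open>v\<close>, and conjugating \<open>t\<close> backwards by \<open>\<alpha>\<close> gives
    the translation by \<open>w\<close>.\<close>
  define w where "w = (\<lambda>j. \<Sum>k<n. B $$ (j, k) * v k)"
  have "(\<Sum>j<n. A $$ (i, j) * w j) = v i" if "i < n" for i
  proof -
    have "(\<Sum>j<n. A $$ (i, j) * w j) = (\<Sum>k<n. (\<Sum>j<n. A $$ (i, j) * B $$ (j, k)) * v k)"
      unfolding w_def sum_distrib_left sum_distrib_right
      by (subst sum.swap) (simp add: algebra_simps)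
    also have "\<dots> = (\<Sum>k<n. (A * B) $$ (i, k) * v k)"
      using A(1) B(1) that by (intro sum.cong) (auto simp: scalar_prod_def atLeast0LessThan)
    also have "\<dots> = (\<Sum>k<n. if k = i then v k else 0)"
      using that by (intro sum.cong) (auto simp: B(2))
    finally show ?thesis using that by simp
  qed
  then have "translation n (\<lambda>i. \<Sum>j<n. A $$ (i, j) * w j) = t"
    by (simp add: v translation_eq_iff)
  then show "inv\<^bsub>SA n\<^esub> \<alpha> \<otimes>\<^bsub>SA n\<^esub> t \<otimes>\<^bsub>SA n\<^esub> \<alpha> \<in> range (translation n)"
    using conj_eqI(2)[OF \<alpha>_SA translation_SA translation_SA comm, of w] by simp
qed

lemma triangular_SA_conj_last_translation:
  fixes \<tau> :: "nat \<Rightarrow> 'k mpoly"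
  assumes \<tau>: "\<tau> \<in> triangular_SA n" and t: "t \<in> last_translations n"
  shows "\<tau> \<otimes>\<^bsub>SA n\<^esub> t \<otimes>\<^bsub>SA n\<^esub> inv\<^bsub>SA n\<^esub> \<tau> \<in> last_translations n"
    and "inv\<^bsub>SA n\<^esub> \<tau> \<otimes>\<^bsub>SA n\<^esub> t \<otimes>\<^bsub>SA n\<^esub> \<tau> \<in> last_translations n"
proof -
  let ?t = "\<lambda>c. translation n (\<lambda>i. if i = n - 1 then c else 0 :: 'k)"
  obtain c where c: "t = ?t c" using t by (auto simp: last_translations_def)
  obtain a P where aP: "\<And>i. i < n \<Longrightarrow> a i \<noteq> 0 \<and> P i \<in> supported {..<i} \<and> \<tau> i = Const (a i) * Var i + P i"
    and \<tau>_SA: "\<tau> \<in> carrier (SA n)"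
    using \<tau> unfolding triangular_SA_def by blast
  have comm: "\<tau> \<otimes>\<^bsub>SA n\<^esub> ?t d = ?t (a (n - 1) * d) \<otimes>\<^bsub>SA n\<^esub> \<tau>" for d
    by (rule triangular_mult_translation[OF SA_endos[OF \<tau>_SA] n]) (use aP in blast)
  show "\<tau> \<otimes>\<^bsub>SA n\<^esub> t \<otimes>\<^bsub>SA n\<^esub> inv\<^bsub>SA n\<^esub> \<tau> \<in> last_translations n"
    using conj_eqI(1)[OF \<tau>_SA translation_SA translation_SA comm] by (simp add: c last_translations_def)
  have "a (n - 1) \<noteq> 0" using aP n by simp
  then have "a (n - 1) * (c / a (n - 1)) = c" by simp
  then have "?t (a (n - 1) * (c / a (n - 1))) = t" by (simp only: c)
  then show "inv\<^bsub>SA n\<^esub> \<tau> \<otimes>\<^bsub>SA n\<^esub> t \<otimes>\<^bsub>SA n\<^esub> \<tau> \<in> last_translations n"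
    using conj_eqI(2)[OF \<tau>_SA translation_SA translation_SA comm, of "c / a (n - 1)"]
    by (simp only: last_translations_def) blast
qed

text \<open>From \<open>\<tau> \<pi> = t \<tau>\<close> substitution of \<open>\<pi>\<close> into
  \<open>\<tau> i\<close> adds \<open>v i\<close>; expanding \<open>\<tau> i\<close> gives the
  formula. As \<open>P i\<close> involves earlier variables only, induction on \<open>i\<close>
  shows that \<open>\<pi>\<close> is triangular with all diagonal coefficients 1.\<close>

lemma triangular_conj_translation:
  fixes \<tau> :: "nat \<Rightarrow> 'k mpoly"
  assumes \<tau>: "\<tau> \<in> carrier (SA n)"
    and aP: "\<And>i. i < n \<Longrightarrow> a i \<noteq> 0 \<and> P i \<in> supported {..<i} \<and> \<tau> i = Const (a i) * Var i + P i"
    and \<pi>: "\<pi> = inv\<^bsub>SA n\<^esub> \<tau> \<otimes>\<^bsub>SA n\<^esub> translation n v \<otimes>\<^bsub>SA n\<^esub> \<tau>"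
    and i: "i < n"
  shows "\<pi> i - Var i \<in> supported {..<i}"
    and "Const (a i) * (\<pi> i - Var i) = Const (v i) + P i - psubst \<pi> (P i)"
proof -
  have "\<tau> \<otimes>\<^bsub>SA n\<^esub> \<pi> = translation n v \<otimes>\<^bsub>SA n\<^esub> \<tau>"
    using \<tau> translation_SA[of n v] by (simp add: \<pi> SA.m_assoc)
  note eq_SA = this[unfolded translation_mult mult_SA]
  have psubst_\<tau>: "psubst \<pi> (\<tau> i) = \<tau> i + Const (v i)" if "i < n" for i
    using that fun_cong[OF eq_SA, of i]
    by (simp add: translation_def)
  have eq: "Const (a i) * (\<pi> i - Var i) = Const (v i) + P i - psubst \<pi> (P i)" if "i < n" for i
    using aP[OF that] psubst_\<tau>[OF that] by (simp add: algebra_simps)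
  show "Const (a i) * (\<pi> i - Var i) = Const (v i) + P i - psubst \<pi> (P i)"
    by (rule eq[OF i])
  show "\<pi> i - Var i \<in> supported {..<i}" using i
  proof (induction i rule: less_induct)
    case (less i)
    have "\<pi> j \<in> supported {..<i}" if "j < i" for j
    proof -
      have "\<pi> j - Var j \<in> supported {..<i}"
        using less that by (intro supported_mono[OF _ less.IH[of j]]) auto
      then have "(\<pi> j - Var j) + Var j \<in> supported {..<i}"
        using that by (intro add_supported) auto
      then show ?thesis by simp
    qed
    then have "psubst \<pi> (P i) \<in> supported {..<i}"
      using aP[OF less.prems] by (intro psubst_supported[of _ "{..<i}"]) auto
    then have "Const (1 / a i) * (Const (v i) + P i - psubst \<pi> (P i)) \<in> supported {..<i}"
      using aP[OF less.prems] by simp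
    moreover have "Const (1 / a i) * (Const (a i) * (\<pi> i - Var i)) = \<pi> i - Var i"
      using aP[OF less.prems] by (simp add: mult.assoc[symmetric] Const_mult[symmetric])
    ultimately show ?case using eq[OF less.prems] by simp
  qed
qed

lemma conj_iterates_stabilize:
  fixes \<tau> h k :: "nat \<Rightarrow> 'k mpoly"
  assumes \<tau>: "\<tau> \<in> triangular_SA n" and h: "h \<in> range (translation n)" and k: "k \<in> range (translation n)"
  shows "\<exists>j. ((\<lambda>p. inv\<^bsub>SA n\<^esub> p \<otimes>\<^bsub>SA n\<^esub> k \<otimes>\<^bsub>SA n\<^esub> p) ^^ j) (inv\<^bsub>SA n\<^esub> \<tau> \<otimes>\<^bsub>SA n\<^esub> h \<otimes>\<^bsub>SA n\<^esub> \<tau>) = k"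
proof -
  obtain u v where u: "h = translation n u" and v: "k = translation n v" using h k by blast
  obtain a P where aP: "\<And>i. i < n \<Longrightarrow> a i \<noteq> 0 \<and> P i \<in> supported {..<i} \<and> \<tau> i = Const (a i) * Var i + P i"
    and \<tau>_SA: "\<tau> \<in> carrier (SA n)"
    using \<tau> unfolding triangular_SA_def by blast
  define \<pi> where "\<pi> = (\<lambda>j. ((\<lambda>p. inv\<^bsub>SA n\<^esub> p \<otimes>\<^bsub>SA n\<^esub> k \<otimes>\<^bsub>SA n\<^esub> p) ^^ j) (inv\<^bsub>SA n\<^esub> \<tau> \<otimes>\<^bsub>SA n\<^esub> h \<otimes>\<^bsub>SA n\<^esub> \<tau>))"
  define Q where "Q = (\<lambda>j i. \<pi> j i - Var i)"
  have \<pi>_Suc: "\<pi> (Suc j) = inv\<^bsub>SA n\<^esub> (\<pi> j) \<otimes>\<^bsub>SA n\<^esub> translation n v \<otimes>\<^bsub>SA n\<^esub> \<pi> j" for j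
    by (simp add: \<pi>_def v)
  have inv: "\<pi> j \<in> carrier (SA n) \<and> (\<forall>i<n. Q j i \<in> supported {..<i})" for j
  proof (induction j)
    case 0
    have \<pi>0: "\<pi> 0 = inv\<^bsub>SA n\<^esub> \<tau> \<otimes>\<^bsub>SA n\<^esub> translation n u \<otimes>\<^bsub>SA n\<^esub> \<tau>" by (simp add: \<pi>_def u)
    then have "\<pi> 0 \<in> carrier (SA n)" using \<tau>_SA translation_SA[of n u] by simp
    then show ?case using triangular_conj_translation(1)[OF \<tau>_SA aP \<pi>0] by (simp add: Q_def)
  next
    case (Suc j)
    then have 1: "\<pi> (Suc j) \<in> carrier (SA n)" using translation_SA[of n v] by (simp add: \<pi>_Suc)
    have "\<pi> (Suc j) i - Var i \<in> supported {..<i}" if "i < n" for i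
      by (rule triangular_conj_translation(1)[of "\<pi> j" "\<lambda>_. 1" "Q j", OF _ _ \<pi>_Suc that])
        (use Suc in \<open>auto simp: Q_def\<close>)
    then show ?case using 1 by (simp add: Q_def)
  qed
  \<comment> \<open>Each iterate is itself triangular with diagonal coefficients 1 and tails
    \<open>Q j\<close>, so the conjugation formula applies with \<open>\<pi> j\<close> in the role
    of \<open>\<tau>\<close>.\<close>
  have step: "Q (Suc j) i = Const (v i) + Q j i - psubst (\<pi> (Suc j)) (Q j i)" if "i < n" for i j
    using triangular_conj_translation(2)[of "\<pi> j" "\<lambda>_. 1" "Q j", OF _ _ \<pi>_Suc that] inv[of j]
    by (auto simp: Q_def)
  have "\<exists>J. \<forall>j\<ge>J. \<forall>i<m. Q j i = Const (v i)" if "m \<le> n" for m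
    using that
  proof (induction m)
    case (Suc m)
    then obtain J where J: "\<And>j i. j \<ge> J \<Longrightarrow> i < m \<Longrightarrow> Q j i = Const (v i)"
      by (meson Suc_leD)
    have m: "m < n" using Suc.prems by simp
    \<comment> \<open>\<open>Q j m\<close> involves only the variables below \<open>m\<close>, on
      which the next iterate already acts as the translation by \<open>v\<close>. Substitution
      becomes a shift, and the recursion a finite difference.\<close>
    have step': "Q (Suc j) m = Const (v m) - (shift v (Q j m) - Q j m)" if "j \<ge> J" for j
    proof -
      have "\<pi> (Suc j) i = Var i + Const (v i)" if "i < m" for i
        using J[of "Suc j" i] that \<open>j \<ge> J\<close> by (simp add: Q_def diff_eq_eq add.commute)
      then have "psubst (\<pi> (Suc j)) (Q j m) = shift v (Q j m)"
        unfolding shift_def using inv[of j] m by (intro psubst_cong[of _ "{..<m}"]) auto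
      then show ?thesis using step[OF m, of j] by simp
    qed
    \<comment> \<open>The difference lowers the degree in every round; the added constant
      \<open>v m\<close> stops the descent at the constants rather than at 0.\<close>
    have "\<exists>j'\<ge>j. Q j' m \<in> degree_below 1" if "j \<ge> J" "Q j m \<in> degree_below (Suc d)" for d j
      using that
    proof (induction d arbitrary: j)
      case (Suc d)
      have "shift v (Q j m) - Q j m \<in> degree_below (Suc d)"
        using Suc.prems by (intro shift_diff_degree)
      moreover have "Const (v m) \<in> degree_below (Suc d)"
        by (rule degree_below_mono[OF _ Const_degree_below]) simp
      ultimately have "Q (Suc j) m \<in> degree_below (Suc d)"
        unfolding step'[OF Suc.prems(1)] by (rule degree_below_diff[rotated])
      then show ?case using Suc.IH[of "Suc j"] Suc.prems(1) by (meson Suc_leD le_Suc_eq)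
    qed auto
    moreover obtain d where "Q J m \<in> degree_below d" using degree_below_exists by blast
    then have "Q J m \<in> degree_below (Suc d)" by (rule degree_below_mono[rotated]) simp
    ultimately obtain j' where j': "j' \<ge> J" "Q j' m \<in> degree_below 1" by blast
    obtain c where c: "Q j' m = Const c" using degree_below_1 j'(2) by auto
    \<comment> \<open>A constant has zero difference, so one more round produces exactly
      \<open>v m\<close>, and this value then persists.\<close>
    have const: "Q (Suc j) m = Const (v m)" if "j \<ge> J" "Q j m = Const c'" for j c'
      using step'[OF that(1)] that(2) by (simp add: shift_def)
    have "Q j m = Const (v m)" if "j \<ge> Suc j'" for j
      using that
    proof (induction j rule: dec_induct)
      case base
      show ?case using const[OF j'(1) c] .
    next
      case (step i)
      then show ?case using const[of i "v m"] j'(1) by simp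
    qed
    then have "\<forall>j\<ge>Suc j'. \<forall>i<Suc m. Q j i = Const (v i)"
      using J j'(1) by (auto simp: less_Suc_eq)
    then show ?case by blast
  qed simp
  then obtain J where "\<forall>i<n. Q J i = Const (v i)" by blast
  then have "\<pi> J = k"
    using inv[of J] SA_endos[of "\<pi> J" n] unfolding v
    by (intro endo_eqI[of _ n]) (auto simp: Q_def translation_def PiE_def diff_eq_eq add.commute)
  then show ?thesis unfolding \<pi>_def by blast
qed

end


section \<open>Splitting off a scaling\<close>

text \<open>Only \<open>x_0\<close> is rescaled, so the Jacobian determinant is \<open>c\<close>.
  These maps compensate the determinants of factors outside \<open>SA n\<close>.\<close>

definition scaling :: "nat \<Rightarrow> 'k \<Rightarrow> nat \<Rightarrow> 'k::comm_ring_1 mpoly"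
  where "scaling n c = (\<lambda>i\<in>{..<n}. Const (if i = 0 then c else 1) * Var i)"

lemma lookup_Const_mult: "Poly_Mapping.lookup (Const a * p) m = a * Poly_Mapping.lookup p m"
  for p :: "'k::semiring_0 mpoly"
proof (induction p rule: single_induct)
  case (single m' c)
  then show ?case by (simp add: Const_def mult_single lookup_single when_def)
qed (auto simp: lookup_add algebra_simps)

lemma scaling_endos: "scaling n c \<in> endos n"
  by (auto simp: scaling_def)

lemma scaling_mult: "scaling n c \<otimes>\<^bsub>GA n\<^esub> \<phi> = (\<lambda>i\<in>{..<n}. Const (if i = 0 then c else 1) * \<phi> i)"
  by (rule ext) (simp add: mult_GA scaling_def)

lemma scaling_mult_scaling: "scaling n c \<otimes>\<^bsub>GA n\<^esub> scaling n d = scaling n (c * d)"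
  by (auto simp: scaling_mult) (auto simp: scaling_def Const_mult algebra_simps)

lemma scaling_1: "scaling n 1 = \<one>\<^bsub>GA n\<^esub>"
  by (auto simp: scaling_def one_GA)

lemma scaling_GA:
  fixes c :: "'k::field"
  assumes "c \<noteq> 0" shows "scaling n c \<in> carrier (GA n)"
proof (rule GA_I)
  have *: "psubst (scaling n (d::'k)) (scaling n e i) = Var i" if "i < n" "e * d = 1" for i d e
    using that by (auto simp: scaling_def mult.assoc[symmetric] Const_mult[symmetric])
  show "psubst (scaling n (1 / c)) (scaling n c i) = Var i" if "i < n" for i
    using assms that by (intro *) auto
  show "psubst (scaling n c) (scaling n (1 / c) i) = Var i" if "i < n" for i
    using assms that by (intro *) auto
qed (rule scaling_endos)+

lemma det_scaling_jacobian:
  assumes "n > 0" shows "det (jacobian n (scaling n c)) = Const c"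
proof -
  have "jacobian n (scaling n c) = multrow_mat n 0 (Const c)"
    by (rule eq_matI) (auto simp: jacobian_def scaling_def)
  then show ?thesis using assms by (simp add: det_multrow_mat)
qed

text \<open>\<open>\<psi>\<close> is \<open>\<phi>\<close> multiplied by \<open>scaling n c\<close>
  on the left and by the inverse of \<open>scaling n d\<close> on the right. The coordinatewise form
  lets the Jacobian matrix of \<open>\<psi>\<close> be read off directly.\<close>

lemma scaling_conj:
  fixes \<phi> :: "nat \<Rightarrow> 'k::field mpoly"
  assumes "\<phi> \<in> carrier (GA n)" "c \<noteq> 0" "d \<noteq> 0"
  defines "\<psi> \<equiv> \<lambda>i\<in>{..<n}. Const (if i = 0 then c else 1) * psubst (scaling n (1 / d)) (\<phi> i)"
  shows "\<psi> \<in> carrier (GA n)" "scaling n c \<otimes>\<^bsub>GA n\<^esub> \<phi> = \<psi> \<otimes>\<^bsub>GA n\<^esub> scaling n d"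
proof -
  interpret GA: group "GA n :: (nat \<Rightarrow> 'k mpoly) monoid" by (rule group_GA)
  have s: "scaling n c \<in> carrier (GA n)" "scaling n d \<in> carrier (GA n)" "scaling n (1 / d) \<in> carrier (GA n)"
    using assms by (auto intro: scaling_GA)
  have \<psi>: "\<psi> = scaling n c \<otimes>\<^bsub>GA n\<^esub> \<phi> \<otimes>\<^bsub>GA n\<^esub> scaling n (1 / d)"
    unfolding \<psi>_def scaling_mult by (auto simp: mult_GA)
  show "\<psi> \<in> carrier (GA n)" using s assms(1) by (simp add: \<psi>)
  have "scaling n (1 / d) \<otimes>\<^bsub>GA n\<^esub> scaling n d = \<one>\<^bsub>GA n\<^esub>"
    using \<open>d \<noteq> 0\<close> by (simp add: scaling_mult_scaling scaling_1)
  then show "scaling n c \<otimes>\<^bsub>GA n\<^esub> \<phi> = \<psi> \<otimes>\<^bsub>GA n\<^esub> scaling n d"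
    using s assms(1) by (simp add: \<psi> GA.m_assoc)
qed

section \<open>Affine and triangular factors up to a scaling\<close>

interpretation Const_hom: comm_ring_hom "Const :: 'k::comm_ring_1 \<Rightarrow> 'k mpoly"
  by unfold_locales (auto simp: Const_add Const_mult)

lemma det_jacobian_affine_endo:
  assumes "A \<in> carrier_mat n n"
  shows "det (jacobian n (affine_endo n A b)) = Const (det A)"
proof -
  have "jacobian n (affine_endo n A b) = map_mat Const A"
    by (rule eq_matI) (use assms in \<open>auto simp: jacobian_def affine_endo_def\<close>)
  then show ?thesis by simp
qed

lemma total_degree_le_1:
  fixes p :: "'k::comm_semiring_1 mpoly"
  assumes "p \<in> supported {..<n}" "total_degree p \<le> 1"
  shows "\<exists>a b. p = (\<Sum>j<n. Const (a j) * Var j) + Const b"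
proof -
  let ?\<iota> = "\<lambda>j. Poly_Mapping.single j (1::nat)" and ?c = "Poly_Mapping.lookup p"
  have nz: "?\<iota> j \<noteq> 0" for j :: nat by (metis lookup_single_eq lookup_zero zero_neq_one)
  have inj: "inj_on ?\<iota> {..<n}"
    by (auto intro!: inj_onI simp: poly_mapping_eq_iff fun_eq_iff lookup_single when_def split: if_splits)
  have "Poly_Mapping.keys p \<subseteq> insert 0 (?\<iota> ` {..<n})"
  proof
    fix m assume m: "m \<in> Poly_Mapping.keys p"
    then have "monomial_degree m \<le> total_degree p"
      unfolding total_degree_def monomial_degree_def by (intro Max_ge) auto
    then have le: "monomial_degree m \<le> 1" using assms by simp
    show "m \<in> insert 0 (?\<iota> ` {..<n})"
    proof (cases "m = 0")
      case False
      then obtain j where j: "j \<in> Poly_Mapping.keys m" by (metis equals0I keys_eq_empty)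
      have "monomial_degree m = Poly_Mapping.lookup m j +
          (\<Sum>i\<in>Poly_Mapping.keys m - {j}. Poly_Mapping.lookup m i)"
        unfolding monomial_degree_def using j by (intro sum.remove) auto
      moreover have "Poly_Mapping.lookup m j \<noteq> 0" using j by (simp add: in_keys_iff)
      ultimately have 1: "Poly_Mapping.lookup m j = 1"
        and "(\<Sum>i\<in>Poly_Mapping.keys m - {j}. Poly_Mapping.lookup m i) = 0" using le by linarith+
      then have "Poly_Mapping.lookup m i = 0" if "i \<noteq> j" for i
        using that by (cases "i \<in> Poly_Mapping.keys m") (auto simp: not_in_keys_iff_lookup_eq_zero[symmetric])
      then have "m = ?\<iota> j"
        using 1 by (intro poly_mapping_eqI) (auto simp: lookup_single when_def)
      moreover have "j < n" using assms(1) m j by (auto simp: supported_def)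
      ultimately show ?thesis by auto
    qed auto
  qed
  then have "p = (\<Sum>m\<in>insert 0 (?\<iota> ` {..<n}). Poly_Mapping.single m (?c m))"
    by (subst (1) sum_singles[of p, symmetric], intro sum.mono_neutral_left) (auto simp: in_keys_iff)
  also have "\<dots> = Poly_Mapping.single 0 (?c 0) + (\<Sum>m\<in>?\<iota> ` {..<n}. Poly_Mapping.single m (?c m))"
    using nz by (subst sum.insert) auto
  also have "(\<Sum>m\<in>?\<iota> ` {..<n}. Poly_Mapping.single m (?c m)) = (\<Sum>j<n. Const (?c (?\<iota> j)) * Var j)"
    by (subst sum.reindex[OF inj]) (simp add: Const_def Var_def mult_single)
  finally show ?thesis by (auto simp: Const_def add.commute)
qed

lemma Aff_affine_endo:
  fixes \<alpha> :: "nat \<Rightarrow> 'k::field mpoly"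
  assumes "\<alpha> \<in> Aff n"
  obtains A b where "A \<in> carrier_mat n n" "det A \<noteq> 0" "\<alpha> = affine_endo n A b"
proof -
  have \<alpha>: "\<alpha> \<in> carrier (GA n)" and Max: "Max ((\<lambda>i. total_degree (\<alpha> i)) ` {..<n}) = 1"
    using assms by (auto simp: Aff_def)
  have "\<exists>a b. \<alpha> i = (\<Sum>j<n. Const (a j) * Var j) + Const b" if "i < n" for i
  proof (rule total_degree_le_1)
    show "\<alpha> i \<in> supported {..<n}" using GA_endos[OF \<alpha>] that by auto
    show "total_degree (\<alpha> i) \<le> 1" unfolding Max[symmetric] using that by (intro Max_ge) auto
  qed
  then obtain a b where ab: "\<And>i. i < n \<Longrightarrow> \<alpha> i = (\<Sum>j<n. Const (a i j) * Var j) + Const (b i)"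
    by metis
  define A where "A = mat n n (\<lambda>(i, j). a i j)"
  have A: "A \<in> carrier_mat n n" by (simp add: A_def)
  have "\<alpha> = affine_endo n A b"
    using GA_endos[OF \<alpha>] by (intro endo_eqI[of _ n]) (auto simp: affine_endo_def A_def ab PiE_def)
  moreover have "det A \<noteq> 0"
  proof -
    \<comment> \<open>The inverse \<open>\<psi>\<close> is not known to be affine, but comparing the
      coefficients of \<open>x_k\<close> in \<open>psubst \<psi> (\<alpha> i) = Var i\<close>
      involves only its linear coefficients. They form a right inverse \<open>C\<close> of
      \<open>A\<close>.\<close>
    obtain \<psi> where inv: "\<alpha> \<otimes>\<^bsub>poly_endos n\<^esub> \<psi> = \<one>\<^bsub>poly_endos n\<^esub>"
      using \<alpha> by (auto simp: GA_def units_of_def Units_def)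
    have \<psi>: "psubst \<psi> (\<alpha> i) = Var i" if "i < n" for i
      using that fun_cong[OF inv, of i] by (simp add: mult_poly_endos one_poly_endos)
    let ?\<iota> = "\<lambda>j. Poly_Mapping.single j (1::nat)"
    define C where "C = mat n n (\<lambda>(j, k). Poly_Mapping.lookup (\<psi> j) (?\<iota> k))"
    have C: "C \<in> carrier_mat n n" by (simp add: C_def)
    have "A * C = 1\<^sub>m n"
    proof (rule eq_matI)
      fix i k assume "i < dim_row (1\<^sub>m n :: 'k mat)" "k < dim_col (1\<^sub>m n :: 'k mat)"
      then have ik: "i < n" "k < n" by auto
      have "?\<iota> k \<noteq> 0" by (metis lookup_single_eq lookup_zero zero_neq_one)
      then have "(\<Sum>j<n. a i j * Poly_Mapping.lookup (\<psi> j) (?\<iota> k)) = Poly_Mapping.lookup (psubst \<psi> (\<alpha> i)) (?\<iota> k)"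
        using ik by (simp add: ab lookup_add lookup_sum lookup_Const_mult) (simp add: Const_def lookup_single)
      also have "\<dots> = (if i = k then 1 else 0)"
        using ik by (auto simp: \<psi> Var_def lookup_single when_def poly_mapping_eq_iff fun_eq_iff split: if_splits)
      finally show "(A * C) $$ (i, k) = 1\<^sub>m n $$ (i, k)"
        using ik by (simp add: A_def C_def scalar_prod_def atLeast0LessThan)
    qed (use A C in auto)
    then have "det A * det C = 1" using det_mult[OF A C] by simp
    then show ?thesis by auto
  qed
  ultimately show ?thesis using that A by blast
qed

lemma Aff_scaling:
  fixes \<alpha> :: "nat \<Rightarrow> 'k::field mpoly"
  assumes \<alpha>: "\<alpha> \<in> Aff n" and "c \<noteq> 0" "n > 0"
  shows "\<exists>\<sigma> d. \<sigma> \<in> affine_SA n \<and> d \<noteq> 0 \<and> scaling n c \<otimes>\<^bsub>GA n\<^esub> \<alpha> = \<sigma> \<otimes>\<^bsub>GA n\<^esub> scaling n d"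
proof -
  obtain A b where A: "A \<in> carrier_mat n n" "det A \<noteq> 0" and eq: "\<alpha> = affine_endo n A b"
    using Aff_affine_endo[OF \<alpha>] by blast
  \<comment> \<open>The left scaling contributes \<open>c\<close> and the linear part
    \<open>det A\<close>, so dividing by their product leaves determinant 1.\<close>
  define d where "d = c * det A"
  have d: "d \<noteq> 0" using A assms by (simp add: d_def)
  define \<psi> where "\<psi> = (\<lambda>i\<in>{..<n}. Const (if i = 0 then c else 1) * psubst (scaling n (1 / d)) (\<alpha> i))"
  have \<psi>: "\<psi> \<in> carrier (GA n)" "scaling n c \<otimes>\<^bsub>GA n\<^esub> \<alpha> = \<psi> \<otimes>\<^bsub>GA n\<^esub> scaling n d"
    unfolding \<psi>_def using \<alpha> assms d by (auto intro!: scaling_conj simp: Aff_def)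
  \<comment> \<open>Left and right multiplication by diagonal matrices expresses the two scalings:
    \<open>B\<close> is the linear part of \<open>\<psi>\<close>.\<close>
  define B where "B = multrow_mat n 0 c * (A * multrow_mat n 0 (1 / d))"
  have B: "B \<in> carrier_mat n n" using A by (auto simp: B_def intro!: mult_carrier_mat)
  have "det B = c * (det A * (1 / d))"
    using A \<open>n > 0\<close> by (simp add: B_def det_mult[of _ n] det_multrow_mat)
  then have det: "det B = 1" using d A assms by (simp add: d_def)
  have "B $$ (i, j) = (if i = 0 then c else 1) * A $$ (i, j) * (if j = 0 then 1 / d else 1)"
    if "i < n" "j < n" for i j
  proof -
    have AC: "A * multrow_mat n 0 (1 / d) \<in> carrier_mat n n" using A by simp
    have "(A * multrow_mat n 0 (1 / d)) $$ (i, j) =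
        (\<Sum>k\<in>{0..<n}. A $$ (i, k) * multrow_mat n 0 (1 / d) $$ (k, j))"
      using A that by (simp add: scalar_prod_def)
    also have "\<dots> = (\<Sum>k\<in>{0..<n}. if k = j then A $$ (i, j) * (if j = 0 then 1 / d else 1) else 0)"
      by (rule sum.cong) (use that in auto)
    finally have "(A * multrow_mat n 0 (1 / d)) $$ (i, j) = A $$ (i, j) * (if j = 0 then 1 / d else 1)"
      using that by simp
    then show ?thesis
      using AC that carrier_matD[OF A(1)] unfolding B_def multrow_mat[OF AC, symmetric]
      by (auto simp del: index_mult_mat(1))
  qed
  then have "\<psi> = affine_endo n B (\<lambda>i. (if i = 0 then c else 1) * b i)"
    unfolding \<psi>_def eq affine_endo_def
    by (intro restrict_ext)
      (simp add: scaling_def Const_mult sum_distrib_left distrib_left mult.assoc mult.left_commute)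
  moreover from this have "\<psi> \<in> carrier (SA n)"
    using \<psi>(1) B det by (intro SA_I) (simp_all add: det_jacobian_affine_endo)
  ultimately have "\<psi> \<in> affine_SA n" using B det by (auto simp: affine_SA_def)
  then show ?thesis using \<psi>(2) d by blast
qed

lemma BA_scaling:
  fixes \<tau> :: "nat \<Rightarrow> 'k::field mpoly"
  assumes \<tau>: "\<tau> \<in> BA n" and "c \<noteq> 0" "n > 0"
  shows "\<exists>\<sigma> d. \<sigma> \<in> triangular_SA n \<and> d \<noteq> 0 \<and> scaling n c \<otimes>\<^bsub>GA n\<^esub> \<tau> = \<sigma> \<otimes>\<^bsub>GA n\<^esub> scaling n d"
proof -
  obtain a P where aP: "\<And>i. i < n \<Longrightarrow> a i \<noteq> 0 \<and> P i \<in> supported {..<i} \<and> \<tau> i = Const (a i) * Var i + P i"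
    and GA: "\<tau> \<in> carrier (GA n)"
    using \<tau> unfolding BA_def polys_eq_supported by blast
  define d where "d = c * (\<Prod>i<n. a i)"
  have d: "d \<noteq> 0" using aP assms by (simp add: d_def)
  define \<psi> where "\<psi> = (\<lambda>i\<in>{..<n}. Const (if i = 0 then c else 1) * psubst (scaling n (1 / d)) (\<tau> i))"
  have \<psi>: "\<psi> \<in> carrier (GA n)" "scaling n c \<otimes>\<^bsub>GA n\<^esub> \<tau> = \<psi> \<otimes>\<^bsub>GA n\<^esub> scaling n d"
    unfolding \<psi>_def using GA assms d by (auto intro!: scaling_conj)
  \<comment> \<open>Of the diagonal coefficients only the one of \<open>x_0\<close> changes: it
    picks up \<open>c\<close> from the left scaling and \<open>1 / d\<close> from the right
    one.\<close>
  define a' where "a' = (\<lambda>i. a i * (if i = 0 then c / d else 1))"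
  define P' where "P' = (\<lambda>i. Const (if i = 0 then c else 1) * psubst (scaling n (1 / d)) (P i))"
  have \<psi>_eq: "a' i \<noteq> 0" "P' i \<in> supported {..<i}" "\<psi> i = Const (a' i) * Var i + P' i" if "i < n" for i
  proof -
    show "a' i \<noteq> 0" using aP[OF that] assms d by (simp add: a'_def)
    have "psubst (scaling n (1 / d)) (P i) \<in> supported {..<i}"
      using aP[OF that] that by (intro psubst_supported[of _ "{..<i}"]) (auto simp: scaling_def)
    then show "P' i \<in> supported {..<i}" unfolding P'_def by (intro mult_supported Const_supported)
    have "Const (if i = 0 then c else 1) * Const (a i) * Const (if i = 0 then 1 / d else 1) = Const (a' i)"
      by (simp add: a'_def flip: Const_mult)
    then show "\<psi> i = Const (a' i) * Var i + P' i"
      using that aP[OF that] by (simp add: \<psi>_def P'_def scaling_def distrib_left flip: mult.assoc)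
  qed
  have deriv: "partial_deriv j (\<psi> i) = (if i = j then Const (a' i) else 0)" if "i < n" "i \<le> j" for i j
    using \<psi>_eq[OF \<open>i < n\<close>] that by (simp add: partial_deriv_supported[of _ "{..<i}"])
  \<comment> \<open>Coordinate \<open>i\<close> contains no \<open>x_j\<close> with
    \<open>j > i\<close>, so the Jacobian matrix is lower triangular and the choice of
    \<open>d\<close> makes its diagonal product 1.\<close>
  have "det (jacobian n \<psi>) = (\<Prod>i\<in>{0..<n}. jacobian n \<psi> $$ (i, i))"
    by (subst det_lower_triangular[of n]) (auto simp: jacobian_def prod_list_diag_prod deriv)
  also have "\<dots> = Const (\<Prod>i<n. a' i)"
    by (simp add: jacobian_def deriv Const_prod atLeast0LessThan)
  also have "(\<Prod>i<n. a' i) = (\<Prod>i<n. a i) * (c / d)"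
    using \<open>n > 0\<close> by (simp add: a'_def prod.distrib)
  also have "\<dots> = 1" using d by (simp add: d_def)
  finally have "\<psi> \<in> carrier (SA n)" using \<psi>(1) by (intro SA_I) simp_all
  then have "\<psi> \<in> triangular_SA n" using \<psi>_eq unfolding triangular_SA_def by blast
  then show ?thesis using \<psi>(2) d by blast
qed

section \<open>Collecting the scalings of a product at its right end\<close>

definition mult_scalings :: "nat \<Rightarrow> (nat \<Rightarrow> 'k::field mpoly) set \<Rightarrow> (nat \<Rightarrow> 'k mpoly) set"
  where "mult_scalings n S = {\<phi> \<otimes>\<^bsub>GA n\<^esub> scaling n c | \<phi> c. \<phi> \<in> S \<and> c \<noteq> 0}"

text \<open>The trailing scaling is moved past the new factor, which is thereby corrected to an
  element of \<open>T\<close> inside \<open>SA n\<close>; a new scaling trails the longer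
  product.\<close>

lemma mult_scalings_mult:
  fixes \<chi> :: "nat \<Rightarrow> 'k::field mpoly"
  assumes \<chi>: "\<chi> \<in> mult_scalings n S" and S: "S \<subseteq> carrier (SA n)"
    and \<gamma>: "\<gamma> \<in> carrier (GA n)" and T: "T \<subseteq> carrier (SA n)"
    and move: "\<And>c. c \<noteq> 0 \<Longrightarrow> \<exists>\<sigma> d. \<sigma> \<in> T \<and> d \<noteq> 0 \<and>
      scaling n c \<otimes>\<^bsub>GA n\<^esub> \<gamma> = \<sigma> \<otimes>\<^bsub>GA n\<^esub> scaling n d"
  shows "\<chi> \<otimes>\<^bsub>GA n\<^esub> \<gamma> \<in> mult_scalings n (S <#>\<^bsub>SA n\<^esub> T)"
proof -
  interpret GA: group "GA n :: (nat \<Rightarrow> 'k mpoly) monoid" by (rule group_GA)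
  obtain \<phi> c where \<phi>: "\<phi> \<in> S" "c \<noteq> 0" "\<chi> = \<phi> \<otimes>\<^bsub>GA n\<^esub> scaling n c"
    using \<chi> by (auto simp: mult_scalings_def)
  obtain \<sigma> d where \<sigma>: "\<sigma> \<in> T" "d \<noteq> 0" "scaling n c \<otimes>\<^bsub>GA n\<^esub> \<gamma> = \<sigma> \<otimes>\<^bsub>GA n\<^esub> scaling n d"
    using move[OF \<phi>(2)] by blast
  have "\<phi> \<in> carrier (GA n)" "\<sigma> \<in> carrier (GA n)"
    "scaling n c \<in> carrier (GA n)" "scaling n d \<in> carrier (GA n)"
    using \<phi> \<sigma> S T by (auto intro: SA_GA scaling_GA)
  then have "\<chi> \<otimes>\<^bsub>GA n\<^esub> \<gamma> = (\<phi> \<otimes>\<^bsub>GA n\<^esub> \<sigma>) \<otimes>\<^bsub>GA n\<^esub> scaling n d"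
    using \<gamma> \<sigma>(3) by (simp add: \<phi>(3) GA.m_assoc)
  moreover have "\<phi> \<otimes>\<^bsub>GA n\<^esub> \<sigma> = \<phi> \<otimes>\<^bsub>SA n\<^esub> \<sigma>" by (simp add: mult_SA mult_GA)
  ultimately show ?thesis
    using \<phi>(1) \<sigma>(1,2) unfolding mult_scalings_def set_mult_def by auto
qed

lemma affine_SA_subset: "affine_SA n \<subseteq> carrier (SA n)"
  and triangular_SA_subset: "triangular_SA n \<subseteq> carrier (SA n)"
  by (auto simp: affine_SA_def triangular_SA_def)

text \<open>The scaling that is left after moving it past all factors has determinant 1.\<close>

lemma m_triangular_4_SA:
  fixes \<theta> :: "nat \<Rightarrow> 'k::field mpoly"
  assumes group_SA: "group (SA n :: (nat \<Rightarrow> 'k mpoly) monoid)" and "n > 0"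
    and \<theta>: "\<theta> \<in> carrier (SA n)" "m_triangular n 4 \<theta>"
  shows "\<theta> \<in> affine_SA n <#>\<^bsub>SA n\<^esub> triangular_SA n <#>\<^bsub>SA n\<^esub> affine_SA n
    <#>\<^bsub>SA n\<^esub> triangular_SA n <#>\<^bsub>SA n\<^esub> affine_SA n <#>\<^bsub>SA n\<^esub> triangular_SA n
    <#>\<^bsub>SA n\<^esub> affine_SA n <#>\<^bsub>SA n\<^esub> triangular_SA n <#>\<^bsub>SA n\<^esub> affine_SA n"
    (is "\<theta> \<in> ?S")
proof -
  interpret SA: group "SA n :: (nat \<Rightarrow> 'k mpoly) monoid" by (rule group_SA)
  interpret GA: group "GA n :: (nat \<Rightarrow> 'k mpoly) monoid" by (rule group_GA)
  obtain \<alpha> \<tau> where \<alpha>\<tau>: "\<forall>i\<in>{0..4}. \<alpha> i \<in> Aff n" "\<forall>i\<in>{1..4}. \<tau> i \<in> BA n"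
    and "\<theta> = foldl (\<lambda>\<psi> i. \<psi> \<otimes>\<^bsub>GA n\<^esub> \<tau> i \<otimes>\<^bsub>GA n\<^esub> \<alpha> i) (\<alpha> 0) [1..<Suc 4]"
    using \<theta>(2) unfolding m_triangular_def by blast
  moreover have "[1..<Suc 4] = [1, 2, 3, 4]" by (simp add: upt_rec)
  ultimately have \<theta>_eq: "\<theta> = \<alpha> 0 \<otimes>\<^bsub>GA n\<^esub> \<tau> 1 \<otimes>\<^bsub>GA n\<^esub> \<alpha> 1 \<otimes>\<^bsub>GA n\<^esub> \<tau> 2 \<otimes>\<^bsub>GA n\<^esub> \<alpha> 2
      \<otimes>\<^bsub>GA n\<^esub> \<tau> 3 \<otimes>\<^bsub>GA n\<^esub> \<alpha> 3 \<otimes>\<^bsub>GA n\<^esub> \<tau> 4 \<otimes>\<^bsub>GA n\<^esub> \<alpha> 4"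
    by (simp only: foldl.simps)
  have \<alpha>: "\<alpha> i \<in> Aff n" if "i \<le> 4" for i using \<alpha>\<tau>(1) that by simp
  have \<tau>: "\<tau> i \<in> BA n" if "1 \<le> i" "i \<le> 4" for i using \<alpha>\<tau>(2) that by simp
  have GA: "\<gamma> \<in> carrier (GA n)" if "\<gamma> \<in> Aff n \<or> \<gamma> \<in> BA n" for \<gamma> :: "nat \<Rightarrow> 'k mpoly"
    using that by (auto simp: Aff_def BA_def)
  have aff: "\<chi> \<otimes>\<^bsub>GA n\<^esub> \<alpha> i \<in> mult_scalings n (S <#>\<^bsub>SA n\<^esub> affine_SA n)"
    if "\<chi> \<in> mult_scalings n S" "S \<subseteq> carrier (SA n)" "i \<le> 4" for \<chi> S i
    using that \<alpha>[of i] Aff_scaling \<open>n > 0\<close> GA by (intro mult_scalings_mult affine_SA_subset) auto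
  have tri: "\<chi> \<otimes>\<^bsub>GA n\<^esub> \<tau> i \<in> mult_scalings n (S <#>\<^bsub>SA n\<^esub> triangular_SA n)"
    if "\<chi> \<in> mult_scalings n S" "S \<subseteq> carrier (SA n)" "1 \<le> i" "i \<le> 4" for \<chi> S i
    using that \<tau>[of i] BA_scaling \<open>n > 0\<close> GA by (intro mult_scalings_mult triangular_SA_subset) auto
  have "scaling n 1 \<otimes>\<^bsub>GA n\<^esub> \<alpha> 0 = \<alpha> 0"
    using GA \<alpha>[of 0] by (simp add: scaling_1)
  then have "\<alpha> 0 \<in> mult_scalings n (affine_SA n)"
    using Aff_scaling[of "\<alpha> 0" n 1] \<alpha>[of 0] \<open>n > 0\<close> by (auto simp: mult_scalings_def)
  then have "\<theta> \<in> mult_scalings n ?S"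
    unfolding \<theta>_eq
    by (intro aff tri SA.set_mult_closed affine_SA_subset triangular_SA_subset) simp_all
  then obtain \<phi> c where \<phi>: "\<phi> \<in> ?S" "\<theta> = \<phi> \<otimes>\<^bsub>GA n\<^esub> scaling n c" "c \<noteq> 0"
    unfolding mult_scalings_def by blast
  have "?S \<subseteq> carrier (SA n)"
    by (intro SA.set_mult_closed affine_SA_subset triangular_SA_subset)
  then have \<phi>_SA: "\<phi> \<in> carrier (SA n)" using \<phi>(1) by blast
  \<comment> \<open>Cancelling \<open>\<phi>\<close> identifies the remaining scaling with a
    quotient of two elements of \<open>SA n\<close>, so its Jacobian determinant \<open>c\<close>
    must be 1.\<close>
  let ?\<psi> = "inv\<^bsub>SA n\<^esub> \<phi> \<otimes>\<^bsub>SA n\<^esub> \<theta>"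
  have \<psi>: "?\<psi> \<in> carrier (SA n)" using \<phi>_SA \<theta>(1) by simp
  have "\<phi> \<otimes>\<^bsub>GA n\<^esub> ?\<psi> = \<phi> \<otimes>\<^bsub>SA n\<^esub> ?\<psi>" by (simp add: mult_SA mult_GA)
  also have "\<dots> = \<phi> \<otimes>\<^bsub>GA n\<^esub> scaling n c"
    using \<phi>_SA \<theta>(1) by (simp add: SA.m_assoc[symmetric] \<phi>(2)[symmetric])
  finally have "?\<psi> = scaling n c"
    using \<psi> \<phi>_SA scaling_GA[OF \<phi>(3)] by (simp add: SA_GA)
  then have "det (jacobian n (scaling n c)) = 1"
    using \<psi> by (simp add: SA_def)
  then have "c = 1" using det_scaling_jacobian[OF \<open>n > 0\<close>, of c] by simp
  then have "\<theta> = \<phi>" using \<phi>(2) \<phi>_SA SA_GA[of \<phi> n] by (simp add: scaling_1)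
  then show ?thesis using \<phi>(1) by simp
qed

theorem theorem1:
  fixes n :: nat and \<theta> :: "nat \<Rightarrow> 'k::field_char_0 mpoly"
  assumes "n \<ge> 2"
    and "\<theta> \<in> carrier (SA n)"
    and "m_triangular n 4 \<theta>"
    and "\<theta> \<noteq> \<one>\<^bsub>SA n\<^esub>"
  shows "normally_cotame n \<theta>"
proof -
  have "n > 0" using \<open>n \<ge> 2\<close> by simp
  \<comment> \<open>Both normal closures are intersections of normal subgroups, so it suffices that
    every normal \<open>N\<close> containing \<open>\<theta>\<close> contains
    \<open>SL n\<close>.\<close>
  have "SL n \<subseteq> N" if normal: "N \<lhd> SA n" and "\<theta> \<in> N" for N :: "(nat \<Rightarrow> 'k mpoly) set"
  proof (rule ccontr)
    assume not_SL: "\<not> SL n \<subseteq> N"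
    interpret N: normal N "SA n" by (rule normal)
    \<comment> \<open>\<open>N \<lhd> SA n\<close> includes the statement that \<open>SA n\<close>
      is a group, which the lemmas on conjugation take as a hypothesis.\<close>
    have group_SA: "group (SA n :: (nat \<Rightarrow> 'k mpoly) monoid)" ..
    let ?g = "translation n (\<lambda>i. if i = n - 1 then 1 else 0 :: 'k)"
    have g: "?g \<noteq> \<one>\<^bsub>SA n\<^esub>"
      using \<open>n > 0\<close> by (auto simp: translation_0[symmetric] translation_eq_iff)
    \<comment> \<open>This is where the assumption that \<open>N\<close> does not contain
      \<open>SL n\<close> is used: it excludes nontrivial commuting pairs, as the abstract
      four-factor argument requires.\<close>
    have no_commuting: "x = \<one>\<^bsub>SA n\<^esub> \<or> t = \<one>\<^bsub>SA n\<^esub>"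
      if x: "x \<in> N" and t: "t \<in> range (translation n)" and xt: "x \<otimes>\<^bsub>SA n\<^esub> t = t \<otimes>\<^bsub>SA n\<^esub> x" for x t
    proof (rule ccontr)
      assume ne: "\<not> (x = \<one>\<^bsub>SA n\<^esub> \<or> t = \<one>\<^bsub>SA n\<^esub>)"
      obtain v where v: "t = translation n v" using t by blast
      obtain i where "i < n" "v i \<noteq> 0"
        using ne by (auto simp: v translation_0[symmetric] translation_eq_iff)
      then show False
        using SL_subset_of_commuting_translation[OF normal \<open>n \<ge> 2\<close> x] xt ne not_SL
        unfolding v by blast
    qed
    have "\<exists>a0\<in>affine_SA n. \<exists>b1\<in>triangular_SA n. \<exists>a1\<in>affine_SA n. \<exists>b2\<in>triangular_SA n.
        \<exists>a2\<in>affine_SA n. \<exists>b3\<in>triangular_SA n. \<exists>a3\<in>affine_SA n. \<exists>b4\<in>triangular_SA n.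
        \<exists>a4\<in>affine_SA n. \<theta> = a0 \<otimes>\<^bsub>SA n\<^esub> b1 \<otimes>\<^bsub>SA n\<^esub> a1 \<otimes>\<^bsub>SA n\<^esub> b2 \<otimes>\<^bsub>SA n\<^esub> a2
          \<otimes>\<^bsub>SA n\<^esub> b3 \<otimes>\<^bsub>SA n\<^esub> a3 \<otimes>\<^bsub>SA n\<^esub> b4 \<otimes>\<^bsub>SA n\<^esub> a4"
      using m_triangular_4_SA[OF group_SA \<open>n > 0\<close> assms(2,3)] by (simp add: set_mult_def)
    then obtain a0 b1 a1 b2 a2 b3 a3 b4 a4 where ab:
      "\<theta> = a0 \<otimes>\<^bsub>SA n\<^esub> b1 \<otimes>\<^bsub>SA n\<^esub> a1 \<otimes>\<^bsub>SA n\<^esub> b2 \<otimes>\<^bsub>SA n\<^esub> a2 \<otimes>\<^bsub>SA n\<^esub> b3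
        \<otimes>\<^bsub>SA n\<^esub> a3 \<otimes>\<^bsub>SA n\<^esub> b4 \<otimes>\<^bsub>SA n\<^esub> a4"
      "a0 \<in> affine_SA n" "a1 \<in> affine_SA n" "a2 \<in> affine_SA n" "a3 \<in> affine_SA n" "a4 \<in> affine_SA n"
      "b1 \<in> triangular_SA n" "b2 \<in> triangular_SA n" "b3 \<in> triangular_SA n" "b4 \<in> triangular_SA n"
      by - (elim bexE, rule that, assumption+)
    have "\<theta> = \<one>\<^bsub>SA n\<^esub>"
    proof (rule N.four_fold_product_trivial[where T = "range (translation n)" and K = "last_translations n"
          and A = "affine_SA n" and B = "triangular_SA n" and g = ?g,
          OF _ _ _ _ _ _ _ _ _ _ _ ab(2-) ab(1) \<open>\<theta> \<in> N\<close>])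
      show "s \<otimes>\<^bsub>SA n\<^esub> t = t \<otimes>\<^bsub>SA n\<^esub> s"
        if "s \<in> range (translation n)" "t \<in> range (translation n)" for s t :: "nat \<Rightarrow> 'k mpoly"
        using that translation_commute by blast
      show "range (translation n) \<subseteq> carrier (SA n :: (nat \<Rightarrow> 'k mpoly) monoid)"
        using translation_SA by blast
      show "last_translations n \<subseteq> (range (translation n) :: (nat \<Rightarrow> 'k mpoly) set)"
        "?g \<in> last_translations n"
        by (auto simp: last_translations_def)
      show "a \<otimes>\<^bsub>SA n\<^esub> t \<otimes>\<^bsub>SA n\<^esub> inv\<^bsub>SA n\<^esub> a \<in> range (translation n) \<and>
          inv\<^bsub>SA n\<^esub> a \<otimes>\<^bsub>SA n\<^esub> t \<otimes>\<^bsub>SA n\<^esub> a \<in> range (translation n)"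
        if "a \<in> affine_SA n" "t \<in> range (translation n)" for a t :: "nat \<Rightarrow> 'k mpoly"
        using affine_SA_conj_translation[OF \<open>n > 0\<close> group_SA that] by simp
      show "b \<otimes>\<^bsub>SA n\<^esub> t \<otimes>\<^bsub>SA n\<^esub> inv\<^bsub>SA n\<^esub> b \<in> last_translations n \<and>
          inv\<^bsub>SA n\<^esub> b \<otimes>\<^bsub>SA n\<^esub> t \<otimes>\<^bsub>SA n\<^esub> b \<in> last_translations n"
        if "b \<in> triangular_SA n" "t \<in> last_translations n" for b t :: "nat \<Rightarrow> 'k mpoly"
        using triangular_SA_conj_last_translation[OF \<open>n > 0\<close> group_SA that] by simp
    qed (fact g no_commuting affine_SA_subset triangular_SA_subset
        conj_iterates_stabilize[OF \<open>n > 0\<close> group_SA])+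
    then show False using assms(4) by simp
  qed
  then have "SLIN n \<subseteq> N" if "N \<lhd> SA n" "\<theta> \<in> N" for N :: "(nat \<Rightarrow> 'k mpoly) set"
    using that unfolding SLIN_def normal_closure_def by blast
  then show ?thesis
    unfolding normally_cotame_def normal_closure_def[of _ "{\<theta>}"] by blast
qed

end
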